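(* Let $[K]$ be a knot class. If $\delta_V[K]=1$, then $[K]$ is trivial (i.e. $[K]$ is the class of the unknot).
   Context: A polygonal knot is a knot (embedded circle in $\mathbb{R}^3$) that consists of finitely many line segments. The cubic lattice is $\mathbb{L}^3=(\mathbb{R}\times\mathbb{Z}\times\mathbb{Z})\cup(\mathbb{Z}\times\mathbb{R}\times\mathbb{Z})\cup(\mathbb{Z}\times\mathbb{Z}\times\mathbb{R})\subset\mathbb{R}^3$. A lattice knot is a polygonal knot contained in $\mathbb{L}^3$. Its vertices are the points of $V(K):=K\cap\mathbb{Z}^3$. For $a,b\in K$, $d_K(a,b)$ is the length of the shortest path from $a$ to $b$ in $K$, and $d_1(a,b)=\sum_{i=1}^3|a_i-b_i|$. The vertex distortion of a lattice knot $K$ is $\delta_V(K):=\max_{a,b\in V(K)}\frac{d_K(a,b)}{d_1(a,b)}$, where the ratio is taken to be $1$ when $a=b$. A knot class $[K]$ is the ambient isotopy class of a (tame) knot, and its vertex distortion is $\delta_V[K]:=\inf_{K\in[K]}\delta_V(K)$, the infimum being taken over all lattice knots representing the class $[K]$. *)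

theory Defs
  imports "HOL-Analysis.Analysis"
begin

section \<open>Knots and knot classes\<close>

definition knot :: "(real^3) set \<Rightarrow> bool" where
  "knot K \<longleftrightarrow> K homeomorphic sphere (0::complex) 1"

definition polygonal_knot :: "(real^3) set \<Rightarrow> bool" where
  "polygonal_knot K \<longleftrightarrow> knot K \<and>
     (\<exists>S. finite S \<and> K = (\<Union>(a, b)\<in>S. closed_segment a b))"

text \<open>An ambient isotopy is a continuous family, indexed by the unit interval, of homeomorphisms
  of space that starts at the identity; this is a homotopy all of whose stages are
  homeomorphisms. Knots are unoriented sets and ambient isotopy is purely topological.\<close>

definition ambient_isotopic :: "(real^3) set \<Rightarrow> (real^3) set \<Rightarrow> bool" where
  "ambient_isotopic K K' \<longleftrightarrow>
     (\<exists>h. homotopic_with_canon (\<lambda>f. \<exists>g. homeomorphism UNIV UNIV f g) UNIV UNIV id h \<and> h ` K = K')"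

definition tame_knot :: "(real^3) set \<Rightarrow> bool" where
  "tame_knot K \<longleftrightarrow> knot K \<and> (\<exists>P. polygonal_knot P \<and> ambient_isotopic K P)"

definition knot_class :: "(real^3) set \<Rightarrow> (real^3) set set" where
  "knot_class K = {K'. knot K' \<and> ambient_isotopic K K'}"

definition unknot :: "(real^3) set" where
  "unknot = {x. norm x = 1 \<and> x $ 3 = 0}"

section \<open>Lattice knots\<close>

definition cubic_lattice :: "(real^3) set" where
  "cubic_lattice =
     {x. x $ 2 \<in> \<int> \<and> x $ 3 \<in> \<int>} \<union> {x. x $ 1 \<in> \<int> \<and> x $ 3 \<in> \<int>} \<union> {x. x $ 1 \<in> \<int> \<and> x $ 2 \<in> \<int>}"

definition lattice_knot :: "(real^3) set \<Rightarrow> bool" where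
  "lattice_knot K \<longleftrightarrow> polygonal_knot K \<and> K \<subseteq> cubic_lattice"

definition vertices :: "(real^3) set \<Rightarrow> (real^3) set" where
  "vertices K = K \<inter> {x. \<forall>i. x $ i \<in> \<int>}"

section \<open>Vertex distortion\<close>

text \<open>Length of a path as the supremum of the lengths of its inscribed polygons (infinite if the
  path is not rectifiable).\<close>

definition path_length :: "(real \<Rightarrow> 'a::metric_space) \<Rightarrow> ereal" where
  "path_length g =
     (SUP ts\<in>{ts. sorted ts \<and> set ts \<subseteq> {0..1}}.
        ereal (\<Sum>i<length ts - 1. dist (g (ts ! i)) (g (ts ! Suc i))))"

definition knot_dist :: "(real^3) set \<Rightarrow> real^3 \<Rightarrow> real^3 \<Rightarrow> ereal" where
  "knot_dist K a b =
     (INF g\<in>{g. path g \<and> path_image g \<subseteq> K \<and> pathstart g = a \<and> pathfinish g = b}. path_length g)"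

definition dist1 :: "real^'n \<Rightarrow> real^'n \<Rightarrow> real" where
  "dist1 a b = (\<Sum>i\<in>UNIV. \<bar>a $ i - b $ i\<bar>)"

definition distortion_ratio :: "(real^3) set \<Rightarrow> real^3 \<Rightarrow> real^3 \<Rightarrow> ereal" where
  "distortion_ratio K a b = (if a = b then 1 else knot_dist K a b / ereal (dist1 a b))"

text \<open>The maximum is over a finite nonempty set: a lattice knot is compact, and it contains a
  lattice point because the rest of the cubic lattice is a disjoint union of open segments.\<close>

definition vertex_distortion :: "(real^3) set \<Rightarrow> ereal" where
  "vertex_distortion K = Max ((\<lambda>(a, b). distortion_ratio K a b) ` (vertices K \<times> vertices K))"

text \<open>The infimum is taken in the extended reals, so a class without lattice representatives
  would have infinite vertex distortion.\<close>

definition class_vertex_distortion :: "(real^3) set set \<Rightarrow> ereal" where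
  "class_vertex_distortion C = (INF K\<in>{K\<in>C. lattice_knot K}. vertex_distortion K)"

end

theory Submission
  imports Defs
begin

text \<open>Let a lattice knot have vertex distortion below \<open>12/11\<close>. It is a closed lattice walk of even
  length \<open>2n\<close>, and antipodal vertices have knot distance at least \<open>n\<close>, so their \<open>l\<^sub>1\<close>-distance
  exceeds \<open>11n/12\<close>. If \<open>c\<^sub>j\<close> steps are parallel to the \<open>j\<close>-th axis, then the \<open>j\<close>-th coordinate difference
  of antipodal vertices is at most \<open>c\<^sub>j/2\<close> in absolute value; it changes sign half way round while moving by at
  most \<open>2\<close> per step, so for some pair it is at most \<open>1\<close>. The \<open>l\<^sub>1\<close>-distance of that pair is at
  most \<open>n - c\<^sub>j/2 + 1\<close>. Summing the resulting bounds on \<open>c\<^sub>j\<close> over the three axes yields \<open>n \<le> 3\<close>, and then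
  antipodal vertices have \<open>l\<^sub>1\<close>-distance exactly \<open>n\<close>. So the knot is a unit square or a Petrie hexagon of
  a unit cube, and an explicit isotopy by shears and a radial rescaling carries it to the round circle.\<close>

section \<open>Ambient isotopies\<close>

text \<open>Invariance of domain makes the inverse continuous, so the stages of the isotopies below
  only have to be continuous bijections.\<close>

lemma homeomorphism_bijI:
  fixes f :: "'a::euclidean_space \<Rightarrow> 'a"
  assumes "continuous_on UNIV f" "bij f"
  shows "\<exists>g. homeomorphism UNIV UNIV f g"
  using invariance_of_domain_homeomorphism[of UNIV f] assms
  by (metis bij_def open_UNIV order_refl)

lemma ambient_isotopicI:
  fixes H :: "real \<times> (real^3) \<Rightarrow> real^3"
  assumes "continuous_on ({0..1} \<times> UNIV) H" and "\<And>x. H (0, x) = x"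
    and bij: "\<And>t. t \<in> {0..1} \<Longrightarrow> bij (\<lambda>x. H (t, x))"
  shows "ambient_isotopic K ((\<lambda>x. H (1, x)) ` K)"
proof -
  have "\<exists>g. homeomorphism UNIV UNIV (\<lambda>x. H (t, x)) g" if t: "t \<in> {0..1}" for t
  proof (rule homeomorphism_bijI[OF _ bij[OF t]])
    show "continuous_on UNIV (\<lambda>x. H (t, x))"
      by (rule continuous_on_compose2[OF assms(1)]) (use t in \<open>auto intro!: continuous_intros\<close>)
  qed
  \<comment> \<open>Folding the product topology of \<open>homotopic_with\<close> into a subspace of
    the ambient product turns its continuity condition into the assumption on
    \<open>H\<close>.\<close>
  then show ?thesis
    unfolding ambient_isotopic_def homotopic_with_def
    using assms(1,2)
    by (intro exI[of _ "\<lambda>x. H (1, x)"] exI[of _ H] conjI)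
      (simp_all flip: subtopology_Times[of euclidean euclidean _ UNIV, simplified])
qed

lemma homeomorphism_UNIV_compose:
  assumes "\<exists>g. homeomorphism UNIV UNIV f g" "\<exists>g. homeomorphism UNIV UNIV f' g"
  shows "\<exists>g. homeomorphism UNIV UNIV (f \<circ> f') g"
  using assms homeomorphism_compose by blast

lemma ambient_isotopic_sym:
  assumes "ambient_isotopic K K'"
  shows "ambient_isotopic K' K"
proof -
  let ?P = "\<lambda>f::real^3 \<Rightarrow> real^3. \<exists>g. homeomorphism UNIV UNIV f g"
  obtain h where h: "homotopic_with_canon ?P UNIV UNIV id h" "h ` K = K'"
    using assms by (auto simp: ambient_isotopic_def)
  then obtain g where g: "homeomorphism UNIV UNIV h g"
    using homotopic_with_imp_property by blast
  (* If h_t is the given isotopy, then the inverse one is t \<mapsto> h_(1-t) \<circ> g. *)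
  have "homotopic_with ?P euclidean euclidean (id \<circ> g) (h \<circ> g)"
  proof (rule homotopic_with_compose_continuous_map_right[OF h(1)[simplified]])
    show "continuous_map euclidean euclidean g"
      using g by (simp add: homeomorphism_def)
    show "?P (j \<circ> g)" if "?P j" for j
      using that homeomorphism_UNIV_compose homeomorphism_symD[OF g] by blast
  qed
  moreover have "h \<circ> g = id"
    using g by (auto simp: homeomorphism_def)
  moreover have "g ` K' = K"
    using g h(2) by (auto simp: homeomorphism_def image_image)
  ultimately show ?thesis
    unfolding ambient_isotopic_def
    by (intro exI[of _ g] conjI homotopic_with_symD[of _ _ _ g id]) simp_all
qed

lemma ambient_isotopic_trans:
  assumes "ambient_isotopic K K'" "ambient_isotopic K' K''"
  shows "ambient_isotopic K K''"
proof -
  let ?P = "\<lambda>f::real^3 \<Rightarrow> real^3. \<exists>g. homeomorphism UNIV UNIV f g"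
  obtain h h' where h: "homotopic_with_canon ?P UNIV UNIV id h" "h ` K = K'"
    and h': "homotopic_with_canon ?P UNIV UNIV id h'" "h' ` K' = K''"
    using assms by (auto simp: ambient_isotopic_def)
  have Ph: "?P h"
    using h homotopic_with_imp_property by blast
  \<comment> \<open>The second isotopy, precomposed with \<open>h\<close>, starts where the first
    one ends, so the two can be concatenated.\<close>
  have "homotopic_with ?P euclidean euclidean (id \<circ> h) (h' \<circ> h)"
  proof (rule homotopic_with_compose_continuous_map_right[OF h'(1)[simplified]])
    show "continuous_map euclidean euclidean h"
      using Ph by (auto simp: homeomorphism_def)
    show "?P (j \<circ> h)" if "?P j" for j
      using that homeomorphism_UNIV_compose Ph by blast
  qed
  then have "homotopic_with_canon ?P UNIV UNIV id (h' \<circ> h)"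
    using homotopic_with_trans[OF h(1)] by simp
  moreover have "(h' \<circ> h) ` K = K''"
    using h(2) h'(2) by (auto simp: image_comp)
  ultimately show ?thesis
    unfolding ambient_isotopic_def by blast
qed

lemma knot_class_eqI:
  assumes "ambient_isotopic K K'"
  shows "knot_class K = knot_class K'"
  using assms ambient_isotopic_sym ambient_isotopic_trans
  unfolding knot_class_def by blast

text \<open>Each point slides along its line in direction \<open>u\<close>, and
  \<open>\<phi>\<close> is constant on that line, so every stage is undone by subtracting the same
  displacement.\<close>

lemma ambient_isotopic_shear:
  fixes \<phi> :: "real^3 \<Rightarrow> real"
  assumes "continuous_on UNIV \<phi>" and inv: "\<And>x s. \<phi> (x + s *\<^sub>R u) = \<phi> x"
  shows "ambient_isotopic K ((\<lambda>x. x + \<phi> x *\<^sub>R u) ` K)"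
proof -
  define H where "H = (\<lambda>(t, x). x + (t * \<phi> x) *\<^sub>R u)"
  have "ambient_isotopic K ((\<lambda>x. H (1, x)) ` K)"
  proof (rule ambient_isotopicI)
    show "continuous_on ({0..1} \<times> UNIV) H"
      unfolding H_def split_def
      by (intro continuous_intros continuous_on_compose2[OF assms(1)]) auto
    fix t :: real
    show "bij (\<lambda>x. H (t, x))"
    proof (rule bij_betw_byWitness[where f' = "\<lambda>x. x - (t * \<phi> x) *\<^sub>R u"])
      have "\<phi> (x - s *\<^sub>R u) = \<phi> x" for x s
        using inv[of x "-s"] by simp
      then show "\<forall>x\<in>UNIV. H (t, x - (t * \<phi> x) *\<^sub>R u) = x"
        by (simp add: H_def)
    qed (auto simp: H_def inv)
  qed (simp add: H_def)
  then show ?thesis by (simp add: H_def)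
qed

lemma ambient_isotopic_translation: "ambient_isotopic K ((+) c ` K)"
  using ambient_isotopic_shear[of "\<lambda>_. 1" c K] by (simp add: add.commute)

section \<open>Unknottedness of planar star-shaped curves\<close>

definition minkowski_gauge :: "('a::real_normed_vector \<Rightarrow> real) \<Rightarrow> bool" where
  "minkowski_gauge N \<longleftrightarrow> continuous_on UNIV N \<and> (\<forall>x t. t \<ge> 0 \<longrightarrow> N (t *\<^sub>R x) = t * N x) \<and> (\<forall>x. x \<noteq> 0 \<longrightarrow> N x > 0)"

text \<open>Each ray from the origin is stretched linearly, by a factor that moves from 1 to
  \<open>N x / norm x\<close>. At the end the point of the ray with \<open>N x = 1\<close> lands on
  the unit sphere.\<close>

lemma ambient_isotopic_radial:
  assumes "minkowski_gauge N"
  shows "ambient_isotopic {x. x $ 3 = 0 \<and> N x = 1} unknot"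
proof -
  have cont: "continuous_on UNIV N" and hom: "\<And>x t. t \<ge> 0 \<Longrightarrow> N (t *\<^sub>R x) = t * N x"
    and pos: "\<And>x. x \<noteq> 0 \<Longrightarrow> N x > 0"
    using assms by (auto simp: minkowski_gauge_def)
  have N0: "N 0 = 0" using hom[of 0 0] by simp
  have nonneg: "N x \<ge> 0" for x using pos[of x] N0 by (cases "x = 0") auto
  \<comment> \<open>This end map multiplies \<open>x\<close> by \<open>N x / norm x\<close>. Written
    with \<open>sgn\<close> it vanishes at the origin, and it is continuous there because
    \<open>N\<close> tends to 0.\<close>
  define F where "F = (\<lambda>x. N x *\<^sub>R sgn x)"
  have "isCont F x" for x
  proof (cases "x = 0")
    case True
    have "(N \<longlongrightarrow> 0) (at 0)"
      using cont N0 by (metis UNIV_I continuous_on_eq_continuous_at isCont_def open_UNIV)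
    moreover have "\<forall>\<^sub>F x in at 0. norm (F x) \<le> norm (N x)"
      by (auto simp: F_def norm_sgn)
    ultimately have "(F \<longlongrightarrow> 0) (at 0)"
      by (intro Lim_null_comparison[of F "\<lambda>x. norm (N x)"] tendsto_norm_zero)
    then show ?thesis using True by (simp add: isCont_def F_def)
  next
    case False
    moreover have "isCont N x"
      using cont by (simp add: continuous_on_eq_continuous_at)
    ultimately show ?thesis
      unfolding F_def isCont_def by (intro tendsto_scaleR tendsto_sgn tendsto_ident_at)
  qed
  then have contF: "continuous_on UNIV F"
    by (simp add: continuous_at_imp_continuous_on)
  \<comment> \<open>The factor \<open>m\<close> depends only on the direction of \<open>x\<close>,
    so division by it inverts the stage. At the origin a division by zero does no harm, as the
    vector it multiplies is 0.\<close>
  define m where "m = (\<lambda>s x. (1 - s) + s * (N x / norm x))"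
  define H where "H = (\<lambda>(s, x). (1 - s) *\<^sub>R x + s *\<^sub>R F x)"
  have Hm: "H (s, x) = m s x *\<^sub>R x" for s x
    by (simp add: H_def m_def F_def sgn_div_norm scaleR_add_left divide_inverse)
  have mpos: "m s x > 0" if "s \<in> {0..1}" "x \<noteq> 0" for s x
  proof -
    have "N x / norm x > 0" using pos that by simp
    then have "0 < s * (N x / norm x)" if "s > 0"
      using that by (rule mult_pos_pos[rotated])
    then show ?thesis
      using that(1) unfolding m_def by (cases "s = 0") (simp, metis add_nonneg_pos atLeastAtMost_iff diff_ge_0_iff_ge order_less_le)
  qed
  have minv: "m s (t *\<^sub>R x) = m s x" if "t > 0" for s t x
    using that by (simp add: m_def hom)
  have "ambient_isotopic {x. x $ 3 = 0 \<and> N x = 1} ((\<lambda>x. H (1, x)) ` {x. x $ 3 = 0 \<and> N x = 1})"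
  proof (rule ambient_isotopicI)
    show "continuous_on ({0..1} \<times> UNIV) H"
      unfolding H_def split_def
      by (intro continuous_intros continuous_on_compose2[OF contF]) auto
    fix s :: real assume s: "s \<in> {0..1}"
    show "bij (\<lambda>x. H (s, x))"
    proof (rule bij_betw_byWitness[where f' = "\<lambda>x. (1 / m s x) *\<^sub>R x"])
      show "\<forall>x\<in>UNIV. (1 / m s (H (s, x))) *\<^sub>R H (s, x) = x"
      proof
        fix x show "(1 / m s (H (s, x))) *\<^sub>R H (s, x) = x"
          using mpos[OF s, of x] minv[of "m s x" s x] by (cases "x = 0") (auto simp: Hm)
      qed
      show "\<forall>x\<in>UNIV. H (s, (1 / m s x) *\<^sub>R x) = x"
      proof
        fix x show "H (s, (1 / m s x) *\<^sub>R x) = x"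
          using mpos[OF s, of x] minv[of "1 / m s x" s x] by (cases "x = 0") (auto simp: Hm)
      qed
    qed auto
  qed (simp add: H_def)
  moreover have "(\<lambda>x. H (1, x)) ` {x. x $ 3 = 0 \<and> N x = 1} = unknot"
  proof (intro subset_antisym subsetI)
    fix y assume "y \<in> (\<lambda>x. H (1, x)) ` {x. x $ 3 = 0 \<and> N x = 1}"
    then obtain x where x: "y = H (1, x)" "x $ 3 = 0" "N x = 1" by blast
    then have "x \<noteq> 0" using N0 by auto
    then show "y \<in> unknot"
      using x by (auto simp: unknot_def H_def F_def norm_sgn sgn_div_norm)
  next
    fix y assume y: "y \<in> unknot"
    then have "y \<noteq> 0" by (auto simp: unknot_def)
    then have "N y > 0" by (rule pos)
    then have "N ((1 / N y) *\<^sub>R y) = 1" "((1 / N y) *\<^sub>R y) $ 3 = 0" "H (1, (1 / N y) *\<^sub>R y) = y"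
      using y by (auto simp: hom Hm m_def unknot_def)
    then show "y \<in> (\<lambda>x. H (1, x)) ` {x. x $ 3 = 0 \<and> N x = 1}"
      by (metis (mono_tags, lifting) image_eqI mem_Collect_eq)
  qed
  ultimately show ?thesis by simp
qed


lemma minkowski_gauge_compose:
  assumes "minkowski_gauge N" "linear f" "inj f"
  shows "minkowski_gauge (N \<circ> (f::'a::euclidean_space \<Rightarrow> 'b::euclidean_space))"
proof -
  have "continuous_on UNIV (N \<circ> f)"
    using assms by (intro continuous_on_compose) (auto simp: minkowski_gauge_def linear_continuous_on linear_conv_bounded_linear intro: continuous_on_subset)
  moreover have "f x \<noteq> 0" if "x \<noteq> 0" for x
    using assms that linear_injective_0 by blast
  ultimately show ?thesis
    using assms by (auto simp: minkowski_gauge_def linear_cmul)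
qed

text \<open>The shear adding \<open>(a \<bullet> x) *\<^sub>R u\<close> is inverted by subtracting
  the same term, because \<open>a\<close> is orthogonal to \<open>u\<close>. Substituting the
  inverse into \<open>w \<bullet> x\<close> yields the new normal, and composing \<open>N\<close>
  with it the new gauge. The lemma serves to tilt planes.\<close>

lemma ambient_isotopic_linear_shear:
  fixes a u w :: "real^3"
  assumes N: "minkowski_gauge N" and "a \<bullet> u = 0"
  obtains N' where "minkowski_gauge N'"
    "ambient_isotopic {x. w \<bullet> x = 0 \<and> N x = 1} {x. (w - (w \<bullet> u) *\<^sub>R a) \<bullet> x = 0 \<and> N' x = 1}"
proof
  let ?f = "\<lambda>x. x - (a \<bullet> x) *\<^sub>R u" and ?g = "\<lambda>x. x + (a \<bullet> x) *\<^sub>R u"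
  have fg: "?f (?g x) = x" "?g (?f x) = x" for x
    using assms by (simp_all add: inner_add_right inner_diff_right)
  have lin: "linear ?f"
    by (intro linearI) (auto simp: inner_add_right algebra_simps)
  have "inj ?f"
    using fg(2) by (rule inj_on_inverseI)
  then show "minkowski_gauge (N \<circ> ?f)"
    using minkowski_gauge_compose[OF N lin] by blast
  have "ambient_isotopic {x. w \<bullet> x = 0 \<and> N x = 1} (?g ` {x. w \<bullet> x = 0 \<and> N x = 1})"
    using assms(2) by (intro ambient_isotopic_shear) (auto simp: inner_add_right intro!: continuous_intros)
  also have "?g ` {x. w \<bullet> x = 0 \<and> N x = 1} = {x. w \<bullet> ?f x = 0 \<and> N (?f x) = 1}"
  proof (intro subset_antisym subsetI)
    fix x assume "x \<in> ?g ` {x. w \<bullet> x = 0 \<and> N x = 1}"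
    then obtain y where "x = ?g y" "w \<bullet> y = 0" "N y = 1" by blast
    then show "x \<in> {x. w \<bullet> ?f x = 0 \<and> N (?f x) = 1}"
      by (simp only: mem_Collect_eq fg(1))
  next
    fix x assume "x \<in> {x. w \<bullet> ?f x = 0 \<and> N (?f x) = 1}"
    then show "x \<in> ?g ` {x. w \<bullet> x = 0 \<and> N x = 1}"
      using fg(2)[of x] by (metis (mono_tags, lifting) image_eqI mem_Collect_eq)
  qed
  finally show "ambient_isotopic {x. w \<bullet> x = 0 \<and> N x = 1} {x. (w - (w \<bullet> u) *\<^sub>R a) \<bullet> x = 0 \<and> (N \<circ> ?f) x = 1}"
    by (simp add: inner_diff_left inner_diff_right mult.commute)
qed

text \<open>A vertical shear makes the plane horizontal when its normal has a vertical component;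
  otherwise another shear first tilts the vertical plane. The radial isotopy then finishes.\<close>

lemma ambient_isotopic_planar_unknot:
  fixes w :: "real^3"
  assumes "minkowski_gauge N" "w \<noteq> 0"
  shows "ambient_isotopic {x. w \<bullet> x = 0 \<and> N x = 1} unknot"
proof -
  have vertical: "ambient_isotopic {x. w \<bullet> x = 0 \<and> N x = 1} unknot" if N: "minkowski_gauge N" and w: "w $ 3 \<noteq> 0"
    for N and w :: "real^3"
  proof -
    \<comment> \<open>With this horizontal \<open>a\<close>, the new normal
      \<open>w - (w $ 3) *\<^sub>R a\<close> is vertical.\<close>
    define a where "a = (1 / w $ 3) *\<^sub>R w - axis 3 1"
    have "a \<bullet> axis 3 1 = 0"
      using w by (simp add: a_def inner_diff_left inner_axis_axis inner_axis)
    then obtain N' where N': "minkowski_gauge N'"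
      "ambient_isotopic {x. w \<bullet> x = 0 \<and> N x = 1} {x. (w - (w \<bullet> axis 3 1) *\<^sub>R a) \<bullet> x = 0 \<and> N' x = 1}"
      using ambient_isotopic_linear_shear[OF N] by blast
    have "w - (w \<bullet> axis 3 1) *\<^sub>R a = (w $ 3) *\<^sub>R axis 3 1"
      using w by (simp add: a_def inner_axis algebra_simps)
    then have "ambient_isotopic {x. w \<bullet> x = 0 \<and> N x = 1} {x. x $ 3 = 0 \<and> N' x = 1}"
      using N'(2) w by (simp add: inner_axis')
    then show ?thesis
      using ambient_isotopic_radial[OF N'(1)] ambient_isotopic_trans by blast
  qed
  show ?thesis
  proof (cases "w $ 3 = 0")
    case False
    then show ?thesis using vertical assms by blast
  next
    case True
    \<comment> \<open>The plane is vertical here. Shearing along \<open>w\<close> in proportion to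
      height gives its normal the third coordinate \<open>- (w \<bullet> w)\<close>.\<close>
    define a :: "real^3" where "a = axis 3 1"
    have "a \<bullet> w = 0" using True by (simp add: a_def inner_axis')
    then obtain N' where N': "minkowski_gauge N'"
      "ambient_isotopic {x. w \<bullet> x = 0 \<and> N x = 1} {x. (w - (w \<bullet> w) *\<^sub>R a) \<bullet> x = 0 \<and> N' x = 1}"
      using ambient_isotopic_linear_shear[OF assms(1)] by blast
    have "(w - (w \<bullet> w) *\<^sub>R a) $ 3 \<noteq> 0"
      using True assms(2) by (simp add: a_def axis_def)
    then show ?thesis
      using vertical[OF N'(1)] N'(2) ambient_isotopic_trans by blast
  qed
qed

section \<open>Unit squares and cube hexagons\<close>

text \<open>Neither order nor handedness is fixed, so the vectors may be permuted and negated at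
  will.\<close>

definition orthonormal3 :: "real^3 \<Rightarrow> real^3 \<Rightarrow> real^3 \<Rightarrow> bool" where
  "orthonormal3 a b c \<longleftrightarrow> a \<bullet> a = 1 \<and> b \<bullet> b = 1 \<and> c \<bullet> c = 1 \<and> a \<bullet> b = 0 \<and> a \<bullet> c = 0 \<and> b \<bullet> c = 0"

lemma orthonormal3_expand:
  assumes "orthonormal3 a b c"
  shows "x = (a \<bullet> x) *\<^sub>R a + (b \<bullet> x) *\<^sub>R b + (c \<bullet> x) *\<^sub>R c"
proof -
  have dist: "a \<noteq> b" "a \<noteq> c" "b \<noteq> c"
    using assms by (auto simp: orthonormal3_def)
  let ?B = "{a, b, c}"
  have orth: "pairwise orthogonal ?B"
    using assms by (auto simp: pairwise_def orthogonal_def orthonormal3_def inner_commute)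
  have "0 \<notin> ?B"
    using assms by (auto simp: orthonormal3_def)
  then have "independent ?B"
    using orth by (intro pairwise_orthogonal_independent)
  moreover have "card ?B = DIM(real^3)"
    using dist by simp
  ultimately have "x \<in> span ?B"
    using card_eq_dim[of ?B UNIV] by auto
  moreover have "norm i = 1" if "i \<in> ?B" for i
    using that assms by (auto simp: orthonormal3_def norm_eq_1)
  ultimately have "(\<Sum>i\<in>?B. (i \<bullet> x) *\<^sub>R i) = x"
    using orthonormal_basis_expand[of ?B x] orth by (simp add: inner_commute)
  then show ?thesis
    using dist by (simp add: add.assoc)
qed

lemma orthonormal3_eqI:
  assumes "orthonormal3 a b c" "a \<bullet> x = a \<bullet> y" "b \<bullet> x = b \<bullet> y" "c \<bullet> x = c \<bullet> y"
  shows "x = y"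
  using assms orthonormal3_expand by metis

text \<open>In orthonormal coordinates a unit edge becomes a system of linear conditions, which
  reduces equality of polygons to real arithmetic.\<close>

lemma closed_segment_orthonormal:
  assumes "orthonormal3 a b c"
  shows "closed_segment q (q + a) =
    {x. 0 \<le> a \<bullet> x - a \<bullet> q \<and> a \<bullet> x - a \<bullet> q \<le> 1 \<and> b \<bullet> x = b \<bullet> q \<and> c \<bullet> x = c \<bullet> q}" (is "_ = ?R")
proof (intro subset_antisym subsetI)
  fix x assume "x \<in> closed_segment q (q + a)"
  then obtain t where "0 \<le> t" "t \<le> 1" "x = q + t *\<^sub>R a"
    by (auto simp: in_segment algebra_simps)
  then show "x \<in> ?R"
    using assms by (auto simp: orthonormal3_def inner_add_right inner_commute)
next
  fix x assume x: "x \<in> ?R"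
  define t where "t = a \<bullet> x - a \<bullet> q"
  have "x = q + t *\<^sub>R a"
    using x assms by (intro orthonormal3_eqI[OF assms])
      (auto simp: orthonormal3_def inner_add_right inner_commute t_def)
  then show "x \<in> closed_segment q (q + a)"
    using x by (auto simp: in_segment algebra_simps t_def intro!: exI[of _ t])
qed

text \<open>On the plane normal to \<open>c\<close> the unit level is the boundary of a centred
  square of side 1. The last summand vanishes on that plane and makes the gauge positive off
  it.\<close>

lemma minkowski_gauge_square:
  assumes "orthonormal3 a b c"
  shows "minkowski_gauge (\<lambda>x. 2 * max \<bar>a \<bullet> x\<bar> \<bar>b \<bullet> x\<bar> + \<bar>c \<bullet> x\<bar>)"
  unfolding minkowski_gauge_def
proof (intro conjI allI impI)
  fix x :: "real^3" assume "x \<noteq> 0"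
  then have "a \<bullet> x \<noteq> 0 \<or> b \<bullet> x \<noteq> 0 \<or> c \<bullet> x \<noteq> 0"
    using orthonormal3_eqI[OF assms, of x 0] by auto
  then show "0 < 2 * max \<bar>a \<bullet> x\<bar> \<bar>b \<bullet> x\<bar> + \<bar>c \<bullet> x\<bar>"
    by linarith
next
  fix x and t :: real assume "0 \<le> t"
  then show "2 * max \<bar>a \<bullet> t *\<^sub>R x\<bar> \<bar>b \<bullet> t *\<^sub>R x\<bar> + \<bar>c \<bullet> t *\<^sub>R x\<bar> =
    t * (2 * max \<bar>a \<bullet> x\<bar> \<bar>b \<bullet> x\<bar> + \<bar>c \<bullet> x\<bar>)"
    by (simp add: abs_mult max_mult_distrib_left algebra_simps)
qed (intro continuous_intros)

lemma translate_vimage: "(+) p ` {x. p + x \<in> S} = (S :: 'a::ab_group_add set)"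
proof -
  have "(+) p ` ((+) p -` S) = S"
    by (intro surj_image_vimage_eq) (metis surj_plus)
  then show ?thesis by (simp add: vimage_def)
qed

lemma square_boundary_iff:
  fixes X Y Z :: real
  shows "Z = 0 \<and> 2 * max \<bar>X - 1/2\<bar> \<bar>Y - 1/2\<bar> + \<bar>Z\<bar> = 1 \<longleftrightarrow>
    (0 \<le> X \<and> X \<le> 1 \<and> Y = 0 \<and> Z = 0) \<or> (0 \<le> Y \<and> Y \<le> 1 \<and> X = 1 \<and> Z = 0) \<or>
    (0 \<le> X \<and> X \<le> 1 \<and> Y = 1 \<and> Z = 0) \<or> (0 \<le> Y \<and> Y \<le> 1 \<and> X = 0 \<and> Z = 0)"
  by (auto simp: max_def abs_if split: if_splits)

lemma unit_square_unknot:
  assumes "orthonormal3 a b c"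
  shows "ambient_isotopic (closed_segment q (q + a) \<union> closed_segment (q + a) (q + a + b) \<union>
    closed_segment (q + a + b) (q + b) \<union> closed_segment (q + b) q) unknot" (is "ambient_isotopic ?K _")
proof -
  have on: "orthonormal3 b a c" "orthonormal3 a b c"
    using assms by (auto simp: orthonormal3_def inner_commute)
  have inner: "a \<bullet> a = 1" "b \<bullet> b = 1" "c \<bullet> c = 1" "a \<bullet> b = 0" "a \<bullet> c = 0" "b \<bullet> c = 0"
     "b \<bullet> a = 0" "c \<bullet> a = 0" "c \<bullet> b = 0"
    using assms by (auto simp: orthonormal3_def inner_commute)
  let ?p = "- q - (1/2) *\<^sub>R (a + b)"
  let ?S = "{x. c \<bullet> x = 0 \<and> 2 * max \<bar>a \<bullet> x\<bar> \<bar>b \<bullet> x\<bar> + \<bar>c \<bullet> x\<bar> = 1}"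
  \<comment> \<open>Two edges are reversed so that every edge points along \<open>a\<close> or
    \<open>b\<close>, as \<open>closed_segment_orthonormal\<close> expects.\<close>
  have "?K = closed_segment q (q + a) \<union> closed_segment (q + a) (q + a + b) \<union>
    closed_segment (q + b) (q + b + a) \<union> closed_segment q (q + b)"
    by (simp add: closed_segment_commute add.commute add.left_commute)
  also have "\<dots> = {x. ?p + x \<in> ?S}"
  proof (rule set_eqI)
    fix x
    define X Y Z where XYZ: "X = a \<bullet> x - a \<bullet> q" "Y = b \<bullet> x - b \<bullet> q" "Z = c \<bullet> x - c \<bullet> q"
    then have x: "a \<bullet> x = a \<bullet> q + X" "b \<bullet> x = b \<bullet> q + Y" "c \<bullet> x = c \<bullet> q + Z"
      by simp_all
    have "x \<in> {x. ?p + x \<in> ?S} \<longleftrightarrow> Z = 0 \<and> 2 * max \<bar>X - 1/2\<bar> \<bar>Y - 1/2\<bar> + \<bar>Z\<bar> = 1"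
      by (simp add: inner inner_add_right inner_diff_right x)
    then show "x \<in> closed_segment q (q + a) \<union> closed_segment (q + a) (q + a + b) \<union>
        closed_segment (q + b) (q + b + a) \<union> closed_segment q (q + b) \<longleftrightarrow> x \<in> {x. ?p + x \<in> ?S}"
      unfolding on[THEN closed_segment_orthonormal] square_boundary_iff
      by (simp add: inner inner_add_right x)
  qed
  finally have K: "?K = {x. ?p + x \<in> ?S}" .
  have "(+) ?p ` ?K = ?S"
    by (subst K) (rule translate_vimage[of ?p ?S])
  then have "ambient_isotopic ?K ?S"
    using ambient_isotopic_translation[of ?K ?p] by simp
  moreover have "c \<noteq> 0" using inner by auto
  ultimately show ?thesis
    using ambient_isotopic_planar_unknot[OF minkowski_gauge_square[OF assms]] ambient_isotopic_trans by blast
qed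


text \<open>The six edges of the cube with vertices \<open>(\<plusminus>1/2, \<plusminus>1/2, \<plusminus>1/2)\<close> that avoid the two corners with equal
  coordinates form the set where the largest coordinate is \<open>1/2\<close> and the smallest is \<open>-1/2\<close>. Shearing along
  \<open>(1, 1, 1)\<close> by the midrange minus the mean of the coordinates makes this hexagon planar.\<close>

lemma hexagon_iff:
  fixes X Y Z :: real
  shows "max (max (X - 1/2) (Y - 1/2)) (Z - 1/2) = 1/2 \<and> min (min (X - 1/2) (Y - 1/2)) (Z - 1/2) = -1/2 \<longleftrightarrow>
    (0 \<le> X \<and> X \<le> 1 \<and> Y = 1 \<and> Z = 0) \<or> (0 \<le> X \<and> X \<le> 1 \<and> Y = 0 \<and> Z = 1) \<or>
    (0 \<le> Y \<and> Y \<le> 1 \<and> X = 1 \<and> Z = 0) \<or> (0 \<le> Y \<and> Y \<le> 1 \<and> X = 0 \<and> Z = 1) \<or>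
    (0 \<le> Z \<and> Z \<le> 1 \<and> X = 1 \<and> Y = 0) \<or> (0 \<le> Z \<and> Z \<le> 1 \<and> X = 0 \<and> Y = 1)"
proof -
  have max3: "max (max a b) c = M \<longleftrightarrow> a \<le> M \<and> b \<le> M \<and> c \<le> M \<and> (a = M \<or> b = M \<or> c = M)"
    and min3: "min (min a b) c = M \<longleftrightarrow> M \<le> a \<and> M \<le> b \<and> M \<le> c \<and> (a = M \<or> b = M \<or> c = M)" for a b c M :: real
    by (auto simp: max_def min_def)
  have shift: "x - 1/2 \<le> 1/2 \<longleftrightarrow> x \<le> 1" "x - 1/2 = 1/2 \<longleftrightarrow> x = 1" "-1/2 \<le> x - 1/2 \<longleftrightarrow> 0 \<le> x"
    "x - 1/2 = -1/2 \<longleftrightarrow> x = 0" for x :: real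
    by auto
  show ?thesis
    unfolding max3 min3 shift by auto
qed

text \<open>The range of the three coordinates vanishes exactly where they agree. The last summand
  covers that diagonal and vanishes on the plane normal to \<open>a + b + c\<close>, where the
  sheared hexagon lies.\<close>

lemma minkowski_gauge_hexagon:
  assumes "orthonormal3 a b c"
  shows "minkowski_gauge (\<lambda>x. max (max (a \<bullet> x) (b \<bullet> x)) (c \<bullet> x) - min (min (a \<bullet> x) (b \<bullet> x)) (c \<bullet> x) + \<bar>(a + b + c) \<bullet> x\<bar>)"
  unfolding minkowski_gauge_def
proof (intro conjI allI impI)
  fix x :: "real^3" assume "x \<noteq> 0"
  then have "a \<bullet> x \<noteq> 0 \<or> b \<bullet> x \<noteq> 0 \<or> c \<bullet> x \<noteq> 0"
    using orthonormal3_eqI[OF assms, of x 0] by auto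
  then show "0 < max (max (a \<bullet> x) (b \<bullet> x)) (c \<bullet> x) - min (min (a \<bullet> x) (b \<bullet> x)) (c \<bullet> x) + \<bar>(a + b + c) \<bullet> x\<bar>"
    unfolding inner_add_left by linarith
next
  fix x and t :: real assume "0 \<le> t"
  then show "max (max (a \<bullet> t *\<^sub>R x) (b \<bullet> t *\<^sub>R x)) (c \<bullet> t *\<^sub>R x) - min (min (a \<bullet> t *\<^sub>R x) (b \<bullet> t *\<^sub>R x)) (c \<bullet> t *\<^sub>R x) +
      \<bar>(a + b + c) \<bullet> t *\<^sub>R x\<bar> =
    t * (max (max (a \<bullet> x) (b \<bullet> x)) (c \<bullet> x) - min (min (a \<bullet> x) (b \<bullet> x)) (c \<bullet> x) + \<bar>(a + b + c) \<bullet> x\<bar>)"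
    by (simp add: abs_mult max_mult_distrib_left min_mult_distrib_left distrib_left right_diff_distrib)
qed (intro continuous_intros)

lemma centered_hexagon_unknot:
  assumes "orthonormal3 a b c"
  shows "ambient_isotopic {x. max (max (a \<bullet> x) (b \<bullet> x)) (c \<bullet> x) = 1/2 \<and> min (min (a \<bullet> x) (b \<bullet> x)) (c \<bullet> x) = -1/2} unknot"
    (is "ambient_isotopic ?H _")
proof -
  have inner: "a \<bullet> a = 1" "b \<bullet> b = 1" "c \<bullet> c = 1" "a \<bullet> b = 0" "a \<bullet> c = 0" "b \<bullet> c = 0"
     "b \<bullet> a = 0" "c \<bullet> a = 0" "c \<bullet> b = 0"
    using assms by (auto simp: orthonormal3_def inner_commute)
  define u where "u = a + b + c"
  have abc_u: "a \<bullet> u = 1" "b \<bullet> u = 1" "c \<bullet> u = 1" "u \<bullet> u = 3"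
    by (simp_all add: u_def inner_add_left inner_add_right inner)
  define M where "M x = max (max (a \<bullet> x) (b \<bullet> x)) (c \<bullet> x)" for x
  define m where "m x = min (min (a \<bullet> x) (b \<bullet> x)) (c \<bullet> x)" for x
  \<comment> \<open>The divisor 3 is \<open>u \<bullet> u\<close>. On the hexagon the midrange is 0,
    so the shear moves each point to coordinate sum 0 without changing
    \<open>M x - m x\<close>.\<close>
  define \<phi> where "\<phi> x = (M x + m x) / 2 - (u \<bullet> x) / 3" for x
  have M_add: "M (x + s *\<^sub>R u) = M x + s" and m_add: "m (x + s *\<^sub>R u) = m x + s"
    and u_add: "u \<bullet> (x + s *\<^sub>R u) = u \<bullet> x + 3 * s" for x s
    by (simp_all add: M_def m_def inner_add_right abc_u max_add_distrib_left min_add_distrib_left)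
  have \<phi>_add: "\<phi> (x + s *\<^sub>R u) = \<phi> x" for x s
    unfolding \<phi>_def M_add m_add u_add by (simp add: field_simps)
  let ?S = "{x. u \<bullet> x = 0 \<and> M x - m x + \<bar>u \<bullet> x\<bar> = 1}"
  have "continuous_on UNIV \<phi>"
    unfolding \<phi>_def M_def m_def by (intro continuous_intros) auto
  then have "ambient_isotopic ?H ((\<lambda>x. x + \<phi> x *\<^sub>R u) ` ?H)"
    using \<phi>_add by (rule ambient_isotopic_shear)
  also have "(\<lambda>x. x + \<phi> x *\<^sub>R u) ` ?H = ?S"
  proof (intro subset_antisym subsetI)
    fix y assume "y \<in> (\<lambda>x. x + \<phi> x *\<^sub>R u) ` ?H"
    then obtain x where x: "y = x + \<phi> x *\<^sub>R u" "M x = 1/2" "m x = -1/2"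
      by (auto simp: M_def m_def)
    then show "y \<in> ?S"
      by (simp add: x(1) M_add m_add u_add) (simp add: \<phi>_def x)
  next
    fix y assume y: "y \<in> ?S"
    \<comment> \<open>Moving back by the midrange puts the extreme coordinates of \<open>y\<close>
      at \<open>1/2\<close> and \<open>-1/2\<close>, which gives the preimage.\<close>
    define s where "s = (M y + m y) / 2"
    have x: "M (y + (- s) *\<^sub>R u) = 1/2" "m (y + (- s) *\<^sub>R u) = -1/2"
      unfolding M_add m_add using y by (auto simp: s_def field_simps)
    moreover have "y + (- s) *\<^sub>R u + \<phi> (y + (- s) *\<^sub>R u) *\<^sub>R u = y"
      unfolding \<phi>_add using y by (simp add: \<phi>_def s_def)
    ultimately show "y \<in> (\<lambda>x. x + \<phi> x *\<^sub>R u) ` ?H"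
      unfolding M_def m_def by (intro image_eqI[of _ _ "y + (- s) *\<^sub>R u"]) auto
  qed
  finally have "ambient_isotopic ?H ?S" .
  moreover have "u \<noteq> 0" using abc_u by auto
  ultimately show ?thesis
    using ambient_isotopic_planar_unknot[OF minkowski_gauge_hexagon[OF assms], of u] ambient_isotopic_trans
    unfolding M_def m_def u_def by blast
qed

text \<open>The polygon misses only the opposite cube corners \<open>q + b\<close> and
  \<open>q + a + c\<close>. Reversing the direction of \<open>b\<close> turns them into the two
  corners with equal centred coordinates, so that the centred hexagon applies.\<close>

lemma cube_hexagon_unknot:
  assumes "orthonormal3 a b c"
  shows "ambient_isotopic (closed_segment q (q + a) \<union> closed_segment (q + a) (q + a + b) \<union>
    closed_segment (q + a + b) (q + a + b + c) \<union> closed_segment (q + a + b + c) (q + b + c) \<union>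
    closed_segment (q + b + c) (q + c) \<union> closed_segment (q + c) q) unknot" (is "ambient_isotopic ?K _")
proof -
  have on: "orthonormal3 a b c" "orthonormal3 b a c" "orthonormal3 c a b"
    using assms by (auto simp: orthonormal3_def inner_commute)
  have inner: "a \<bullet> a = 1" "b \<bullet> b = 1" "c \<bullet> c = 1" "a \<bullet> b = 0" "a \<bullet> c = 0" "b \<bullet> c = 0"
     "b \<bullet> a = 0" "c \<bullet> a = 0" "c \<bullet> b = 0"
    using assms by (auto simp: orthonormal3_def inner_commute)
  let ?p = "- q - (1/2) *\<^sub>R (a + b + c)"
  let ?S = "{x. max (max (a \<bullet> x) ((- b) \<bullet> x)) (c \<bullet> x) = 1/2 \<and> min (min (a \<bullet> x) ((- b) \<bullet> x)) (c \<bullet> x) = -1/2}"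
  have "?K = closed_segment q (q + a) \<union> closed_segment (q + a) (q + a + b) \<union>
    closed_segment (q + a + b) (q + a + b + c) \<union> closed_segment (q + b + c) (q + b + c + a) \<union>
    closed_segment (q + c) (q + c + b) \<union> closed_segment q (q + c)" (is "_ = ?K'")
    by (simp add: closed_segment_commute add.commute add.left_commute)
  also have "\<dots> = {x. ?p + x \<in> ?S}"
  proof (rule set_eqI)
    fix x
    \<comment> \<open>The coordinate \<open>Y\<close> is measured from \<open>q + b\<close> against
      \<open>b\<close>, in accordance with the sign change.\<close>
    define X Y Z where XYZ: "X = a \<bullet> x - a \<bullet> q" "Y = b \<bullet> q + 1 - b \<bullet> x" "Z = c \<bullet> x - c \<bullet> q"
    then have x: "a \<bullet> x = a \<bullet> q + X" "b \<bullet> x = b \<bullet> q + 1 - Y" "c \<bullet> x = c \<bullet> q + Z"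
      by simp_all
    have "x \<in> {x. ?p + x \<in> ?S} \<longleftrightarrow> max (max (X - 1/2) (Y - 1/2)) (Z - 1/2) = 1/2 \<and>
        min (min (X - 1/2) (Y - 1/2)) (Z - 1/2) = -1/2"
      by (simp add: inner inner_add_right inner_diff_right x)
    then show "x \<in> ?K' \<longleftrightarrow> x \<in> {x. ?p + x \<in> ?S}"
      unfolding on[THEN closed_segment_orthonormal] hexagon_iff
      by (simp add: inner inner_add_right x) argo
  qed
  finally have K: "?K = {x. ?p + x \<in> ?S}" .
  have "(+) ?p ` ?K = ?S"
    by (subst K) (rule translate_vimage[of ?p ?S])
  then have "ambient_isotopic ?K ?S"
    using ambient_isotopic_translation[of ?K ?p] by simp
  moreover have "orthonormal3 a (- b) c"
    using assms by (simp add: orthonormal3_def)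
  ultimately show ?thesis
    using centered_hexagon_unknot ambient_isotopic_trans by blast
qed

section \<open>Lattice loops as closed walks\<close>

text \<open>By the intermediate value theorem, a value halfway between \<open>h a\<close> and the
  value at the midpoint is taken on both halves of the interval.\<close>

lemma no_injective_real_loop:
  fixes h :: "real \<Rightarrow> real"
  assumes "continuous_on {a..b} h" "a < b" "h a = h b"
  shows "\<not> inj_on h {a..<b}"
proof
  assume inj: "inj_on h {a..<b}"
  define m where "m = (a + b) / 2"
  have m: "a < m" "m < b" using assms(2) by (simp_all add: m_def)
  define y where "y = (h a + h m) / 2"
  have "connected (h ` {a..m})" "connected (h ` {m..b})"
    using assms(1) m by (auto intro!: connected_continuous_image elim: continuous_on_subset)
  moreover have "h a \<in> h ` {a..m}" "h m \<in> h ` {a..m}" "h b \<in> h ` {m..b}" "h m \<in> h ` {m..b}"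
    using m by auto
  moreover have "h a \<le> y \<and> y \<le> h m \<or> h m \<le> y \<and> y \<le> h a"
    unfolding y_def by (simp add: field_simps) linarith
  ultimately have "y \<in> h ` {a..m}" "y \<in> h ` {m..b}"
    using assms(3) unfolding connected_iff_interval by metis+
  then obtain s t where st: "s \<in> {a..m}" "t \<in> {m..b}" "h s = y" "h t = y"
    by (auto simp: image_iff)
  have "h a \<noteq> h m"
    using inj_onD[OF inj, of a m] m by auto
  then have "y \<noteq> h a" "y \<noteq> h m"
    by (auto simp: y_def field_simps)
  then have "s < m" "m < t" "t < b"
    using st assms(3) by (auto simp: order_less_le)
  then show False
    using inj_onD[OF inj, of s t] st by auto
qed

section \<open>Edges of the cubic lattice\<close>

lemma mem_cubic_lattice_iff: "x \<in> cubic_lattice \<longleftrightarrow> (\<exists>j. \<forall>i. i \<noteq> j \<longrightarrow> x $ i \<in> \<int>)"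
proof -
  have "(\<exists>j::3. P j) \<longleftrightarrow> P 1 \<or> P 2 \<or> P 3" for P
    using exhaust_3 by metis
  then show ?thesis
    unfolding cubic_lattice_def by (auto simp: forall_3)
qed

lemma connected_Ints_const:
  fixes A :: "real set"
  assumes "connected A" "A \<subseteq> \<int>" "x \<in> A" "y \<in> A"
  shows "x = y"
proof -
  have *: False if "x \<in> A" "y \<in> A" "x < y" for x y
  proof -
    have "x \<in> \<int>" "y \<in> \<int>"
      using assms(2) that by auto
    then obtain m n where mn: "x = of_int m" "y = of_int n"
      by (elim Ints_cases)
    then have "m + 1 \<le> n" using that by simp
    then have "x \<le> x + 1/2" "x + 1/2 \<le> y"
      using mn by linarith+
    then have "x + 1/2 \<in> A"
      using assms(1) that unfolding connected_iff_interval by blast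
    then have "x + 1/2 \<in> \<int>"
      using assms(2) by auto
    then obtain k where "x + 1/2 = of_int k"
      by (elim Ints_cases)
    then have "2 * m + 1 = 2 * k"
      using mn(1) by linarith
    then show False by presburger
  qed
  show ?thesis
    using *[of x y] *[of y x] assms(3,4) by (cases x y rule: linorder_cases) auto
qed

lemma connected_disjoint_Ints_floor:
  fixes A :: "real set"
  assumes "connected A" "A \<inter> \<int> = {}" "x \<in> A" "y \<in> A"
  shows "\<lfloor>x\<rfloor> = \<lfloor>y\<rfloor>"
proof -
  have *: False if "x \<in> A" "y \<in> A" "\<lfloor>x\<rfloor> < \<lfloor>y\<rfloor>" for x y
  proof -
    have "x \<le> of_int \<lfloor>y\<rfloor>" "of_int \<lfloor>y\<rfloor> \<le> y"
      using that by linarith+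
    then have "of_int \<lfloor>y\<rfloor> \<in> A"
      using assms(1) that unfolding connected_iff_interval by blast
    then show False using assms(2) by auto
  qed
  show ?thesis
    using *[of x y] *[of y x] assms(3,4) by (cases "\<lfloor>x\<rfloor>" "\<lfloor>y\<rfloor>" rule: linorder_cases) auto
qed

definition lattice_points :: "(real^'n) set" where
  "lattice_points = {x. \<forall>i. x $ i \<in> \<int>}"

text \<open>Off the lattice points a point of the cubic lattice has exactly one non-integer
  coordinate, and which one it is cannot change on a connected set. So \<open>S\<close> stays inside
  a single open edge.\<close>

lemma connected_off_lattice_points:
  assumes conn: "connected S" and "x0 \<in> S" and S: "S \<subseteq> cubic_lattice" "S \<inter> lattice_points = {}"
  obtains j where "\<And>x i. x \<in> S \<Longrightarrow> i \<noteq> j \<Longrightarrow> x $ i = x0 $ i"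
    "\<And>x. x \<in> S \<Longrightarrow> \<lfloor>x $ j\<rfloor> = \<lfloor>x0 $ j\<rfloor>"
proof -
  obtain j where j: "\<forall>i. i \<noteq> j \<longrightarrow> x0 $ i \<in> \<int>"
    using S \<open>x0 \<in> S\<close> mem_cubic_lattice_iff by blast
  define A where "A = S \<inter> (\<Inter>i\<in>-{j}. {x. x $ i \<in> \<int>})"
  \<comment> \<open>Of the two descriptions of \<open>A\<close>, integrality of the other
    coordinates shows that it is closed in \<open>S\<close>, and non-integrality of the
    \<open>j\<close>-th that it is open.\<close>
  have A_eq: "A = S \<inter> {x. x $ j \<notin> \<int>}"
  proof (intro subset_antisym subsetI)
    fix x assume "x \<in> A"
    then show "x \<in> S \<inter> {x. x $ j \<notin> \<int>}"
      using S(2) unfolding A_def lattice_points_def by blast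
  next
    fix x assume x: "x \<in> S \<inter> {x. x $ j \<notin> \<int>}"
    then obtain k where "\<forall>i. i \<noteq> k \<longrightarrow> x $ i \<in> \<int>"
      using S mem_cubic_lattice_iff by blast
    then show "x \<in> A" using x unfolding A_def by (cases "k = j") auto
  qed
  have cl: "closed {x::real^3. x $ i \<in> \<int>}" for i
  proof -
    have "closed ((\<lambda>x::real^3. x $ i) -` \<int>)"
      by (intro continuous_closed_vimage closed_Ints continuous_intros)
    then show ?thesis by (simp add: vimage_def)
  qed
  have "closedin (top_of_set S) A"
    unfolding A_def using cl by (intro closedin_closed_Int closed_INT) auto
  moreover have "openin (top_of_set S) A"
    unfolding A_eq using cl[of j] by (intro openin_open_Int) (simp add: closed_def Collect_neg_eq)
  moreover have "x0 \<in> A"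
    using j \<open>x0 \<in> S\<close> by (auto simp: A_def)
  ultimately have "A = S"
    using conn unfolding connected_clopen by blast
  have img: "connected ((\<lambda>x. x $ i) ` S)" for i
    using conn by (intro connected_continuous_image continuous_intros)
  show ?thesis
  proof
    fix x i assume x: "x \<in> S" "i \<noteq> j"
    have "(\<lambda>x. x $ i) ` S \<subseteq> \<int>"
      using x(2) \<open>A = S\<close> unfolding A_def by blast
    then show "x $ i = x0 $ i"
      using x \<open>x0 \<in> S\<close> by (intro connected_Ints_const[OF img]) auto
  next
    fix x assume x: "x \<in> S"
    have "(\<lambda>x. x $ j) ` S \<inter> \<int> = {}"
      using \<open>A = S\<close> unfolding A_eq by blast
    then show "\<lfloor>x $ j\<rfloor> = \<lfloor>x0 $ j\<rfloor>"
      using x \<open>x0 \<in> S\<close> by (intro connected_disjoint_Ints_floor[OF img]) auto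
  qed
qed

lemma Ints_between:
  fixes x :: real
  assumes "x \<in> \<int>" "of_int k \<le> x" "x \<le> of_int k + 1"
  shows "x = of_int k \<or> x = of_int k + 1"
  using assms by (auto elim!: Ints_cases)

text \<open>The interior of the arc lies in one open edge, so the arc lies in the closed edge.
  Injectivity keeps its two ends apart, and then by connectedness it covers the whole edge.\<close>

lemma arc_between_lattice_points:
  fixes \<gamma> :: "real \<Rightarrow> real^3"
  assumes cont: "continuous_on {a..b} \<gamma>" and "a < b" and inj: "inj_on \<gamma> {a..<b}"
    and sub: "\<gamma> ` {a..b} \<subseteq> cubic_lattice" and ends: "\<gamma> a \<in> lattice_points" "\<gamma> b \<in> lattice_points"
    and off: "\<And>t. a < t \<Longrightarrow> t < b \<Longrightarrow> \<gamma> t \<notin> lattice_points"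
  obtains j and \<sigma> :: real where "\<bar>\<sigma>\<bar> = 1" "\<gamma> b = \<gamma> a + \<sigma> *\<^sub>R axis j 1" "\<gamma> ` {a..b} = closed_segment (\<gamma> a) (\<gamma> b)"
proof -
  define S where "S = \<gamma> ` {a<..<b}"
  define x0 where "x0 = \<gamma> ((a + b) / 2)"
  have "connected S"
    unfolding S_def by (intro connected_continuous_image continuous_on_subset[OF cont]) auto
  moreover have "x0 \<in> S" using \<open>a < b\<close> by (auto simp: S_def x0_def)
  moreover have "S \<subseteq> cubic_lattice" using sub by (auto simp: S_def)
  moreover have "S \<inter> lattice_points = {}" using off by (auto simp: S_def)
  ultimately obtain j where j: "\<And>x i. x \<in> S \<Longrightarrow> i \<noteq> j \<Longrightarrow> x $ i = x0 $ i"
    "\<And>x. x \<in> S \<Longrightarrow> \<lfloor>x $ j\<rfloor> = \<lfloor>x0 $ j\<rfloor>"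
    using connected_off_lattice_points by metis
  define k where "k = \<lfloor>x0 $ j\<rfloor>"
  define T where "T = (\<Inter>i\<in>-{j}. {x. x $ i = x0 $ i}) \<inter> {x. of_int k \<le> x $ j} \<inter> {x. x $ j \<le> of_int k + 1}"
  have "closed T"
    unfolding T_def by (intro closed_Int closed_INT ballI closed_Collect_eq closed_Collect_le continuous_intros)
  have "S \<subseteq> T"
  proof
    fix x assume "x \<in> S"
    then show "x \<in> T"
      using j(1)[of x] j(2)[of x] unfolding T_def k_def by simp linarith
  qed
  have T: "\<gamma> ` {a..b} \<subseteq> T"
  proof -
    have "\<gamma> ` closure {a<..<b} \<subseteq> T"
      using \<open>a < b\<close> cont \<open>closed T\<close> \<open>S \<subseteq> T\<close> by (intro image_closure_subset) (auto simp: S_def)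
    then show ?thesis using \<open>a < b\<close> by simp
  qed
  have T_coord: "\<gamma> t $ i = x0 $ i" if "t \<in> {a..b}" "i \<noteq> j" for t i
    using image_subset_iff[THEN iffD1, OF T, rule_format, OF that(1)] that(2) by (simp add: T_def)
  have contj: "continuous_on {a..b} (\<lambda>t. \<gamma> t $ j)"
    using cont by (intro continuous_intros)
  have "inj_on (\<lambda>t. \<gamma> t $ j) {a..<b}"
  proof (rule inj_onI)
    fix s t assume st: "s \<in> {a..<b}" "t \<in> {a..<b}" "\<gamma> s $ j = \<gamma> t $ j"
    have "\<gamma> s $ i = \<gamma> t $ i" for i
      using st T_coord[of s i] T_coord[of t i] by (cases "i = j") auto
    then have "\<gamma> s = \<gamma> t" by (simp add: vec_eq_iff)
    then show "s = t" using inj st by (auto dest: inj_onD)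
  qed
  \<comment> \<open>Injectivity on the half-open interval alone would allow equal ends, as when the
    whole loop meets a single lattice point; on a line this cannot happen.\<close>
  then have neq: "\<gamma> a $ j \<noteq> \<gamma> b $ j"
    using no_injective_real_loop[OF contj \<open>a < b\<close>] by blast
  have "\<gamma> a $ j = of_int k \<or> \<gamma> a $ j = of_int k + 1" "\<gamma> b $ j = of_int k \<or> \<gamma> b $ j = of_int k + 1"
  proof -
    have "\<gamma> a \<in> T" "\<gamma> b \<in> T"
      using T \<open>a < b\<close> by auto
    then show "\<gamma> a $ j = of_int k \<or> \<gamma> a $ j = of_int k + 1" "\<gamma> b $ j = of_int k \<or> \<gamma> b $ j = of_int k + 1"
      using ends unfolding lattice_points_def T_def by (intro Ints_between; simp)+
  qed
  define \<sigma> where "\<sigma> = \<gamma> b $ j - \<gamma> a $ j"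
  have \<sigma>: "\<bar>\<sigma>\<bar> = 1" and jk: "{of_int k, of_int k + 1} = {\<gamma> a $ j, \<gamma> b $ j}"
    using neq \<open>\<gamma> a $ j = _ \<or> _\<close> \<open>\<gamma> b $ j = _ \<or> _\<close> by (auto simp: \<sigma>_def)
  have step: "\<gamma> b = \<gamma> a + \<sigma> *\<^sub>R axis j 1"
    using T_coord[of a] T_coord[of b] \<open>a < b\<close> by (auto simp: vec_eq_iff axis_def \<sigma>_def)
  have "T \<subseteq> \<gamma> ` {a..b}"
  proof
    fix x assume x: "x \<in> T"
    have "connected ((\<lambda>t. \<gamma> t $ j) ` {a..b})"
      using contj by (intro connected_continuous_image) auto
    moreover have "of_int k \<in> (\<lambda>t. \<gamma> t $ j) ` {a..b}" "of_int k + 1 \<in> (\<lambda>t. \<gamma> t $ j) ` {a..b}"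
    proof -
      have "\<gamma> a $ j \<in> (\<lambda>t. \<gamma> t $ j) ` {a..b}" "\<gamma> b $ j \<in> (\<lambda>t. \<gamma> t $ j) ` {a..b}"
        using \<open>a < b\<close> by auto
      then show "of_int k \<in> (\<lambda>t. \<gamma> t $ j) ` {a..b}" "of_int k + 1 \<in> (\<lambda>t. \<gamma> t $ j) ` {a..b}"
        using jk by (metis empty_iff insert_iff)+
    qed
    ultimately have "x $ j \<in> (\<lambda>t. \<gamma> t $ j) ` {a..b}"
      using x unfolding connected_iff_interval T_def by blast
    then obtain t where t: "t \<in> {a..b}" "x $ j = \<gamma> t $ j" by blast
    have "x $ i = \<gamma> t $ i" for i
      using t x T_coord[of t i] by (cases "i = j") (auto simp: T_def)
    then show "x \<in> \<gamma> ` {a..b}" using t by (metis image_eqI vec_eq_iff)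
  qed
  moreover have "T = closed_segment (\<gamma> a) (\<gamma> b)"
  proof (intro subset_antisym subsetI)
    have "convex {x::real^3. x $ i = c}" "convex {x::real^3. c \<le> x $ i}" "convex {x::real^3. x $ i \<le> c}" for i c
      using convex_hyperplane[of "axis i 1 :: real^3" c] convex_halfspace_ge[of c "axis i 1 :: real^3"]
        convex_halfspace_le[of "axis i 1 :: real^3" c]
      by (simp_all add: inner_axis')
    then have "convex T"
      unfolding T_def by (intro convex_Int convex_INT)
    moreover have "\<gamma> a \<in> T" "\<gamma> b \<in> T"
      using T \<open>a < b\<close> by auto
    ultimately have "closed_segment (\<gamma> a) (\<gamma> b) \<subseteq> T"
      by (simp add: closed_segment_subset)
    then show "x \<in> T" if "x \<in> closed_segment (\<gamma> a) (\<gamma> b)" for x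
      using that by blast
  next
    fix x assume x: "x \<in> T"
    define u where "u = (x $ j - \<gamma> a $ j) / \<sigma>"
    have "0 \<le> u" "u \<le> 1"
      using x jk neq by (auto simp: u_def T_def \<sigma>_def divide_simps doubleton_eq_iff)
    moreover have "x = \<gamma> a + (u * \<sigma>) *\<^sub>R axis j 1"
      using x T_coord[of a] \<open>a < b\<close> neq by (auto simp: vec_eq_iff axis_def u_def T_def \<sigma>_def)
    ultimately show "x \<in> closed_segment (\<gamma> a) (\<gamma> b)"
      by (auto simp: in_segment step algebra_simps intro!: exI[of _ u])
  qed
  ultimately show ?thesis
    using that[OF \<sigma> step] T by auto
qed

text \<open>The standard parametrization of the unit circle is rotated to start at the image of
  \<open>p\<close> and then transported to \<open>K\<close>.\<close>

lemma circle_parametrization: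
  fixes K :: "'a::metric_space set"
  assumes "K homeomorphic sphere (0::complex) 1" "p \<in> K"
  obtains \<gamma> :: "real \<Rightarrow> 'a" where "continuous_on {0..1} \<gamma>" "\<gamma> 0 = p" "\<gamma> 1 = p" "inj_on \<gamma> {0..<1}" "\<gamma> ` {0..1} = K"
proof -
  obtain f g where fg: "homeomorphism K (sphere (0::complex) 1) f g"
    using assms(1) by (auto simp: homeomorphic_def)
  have gf: "\<And>x. x \<in> K \<Longrightarrow> g (f x) = x" and f: "f ` K = sphere 0 1" and g: "g ` sphere 0 1 = K"
    and contg: "continuous_on (sphere 0 1) g" and fg': "\<And>z. z \<in> sphere 0 1 \<Longrightarrow> f (g z) = z"
    using fg by (auto simp: homeomorphism_def)
  have fp: "cmod (f p) = 1"
    using f assms(2) by (metis dist_0_norm image_eqI mem_sphere)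
  define z where "z = (\<lambda>t::real. f p * cis (2 * pi * t))"
  have z: "z t \<in> sphere 0 1" for t
    by (simp add: z_def norm_mult fp)
  show ?thesis
  proof
    show "continuous_on {0..1} (\<lambda>t. g (z t))"
      by (rule continuous_on_compose2[OF contg]) (use z in \<open>auto simp: z_def intro!: continuous_intros\<close>)
    show "g (z 0) = p" "g (z 1) = p"
      using gf assms(2) by (simp_all add: z_def)
    show "inj_on (\<lambda>t. g (z t)) {0..<1}"
    proof (rule inj_onI)
      fix s t :: real assume st: "s \<in> {0..<1}" "t \<in> {0..<1}" "g (z s) = g (z t)"
      then have "z s = z t" using fg' z by metis
      then have "cis (2 * pi * s) = cis (2 * pi * t)"
        using fp by (auto simp: z_def)
      then obtain n :: int where "2 * pi * s = 2 * pi * t + 2 * pi * n"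
        using sin_cos_eq_iff[of "2 * pi * s" "2 * pi * t"] by (auto simp: complex_eq_iff)
      then have "2 * pi * s = 2 * pi * (t + n)"
        by (simp add: distrib_left)
      then have n: "s = t + n"
        by (metis mult_left_cancel mult_eq_0_iff pi_neq_zero zero_neq_numeral)
      then have "real_of_int n < 1" "- 1 < real_of_int n" using st by auto
      then have "n = 0" by linarith
      then show "s = t" using n by simp
    qed
    show "(\<lambda>t. g (z t)) ` {0..1} = K"
    proof (intro subset_antisym subsetI)
      show "x \<in> K" if "x \<in> (\<lambda>t. g (z t)) ` {0..1}" for x
        using that g z by blast
      fix x assume x: "x \<in> K"
      then have fx: "cmod (f x) = 1"
        using f by (metis dist_0_norm image_eqI mem_sphere)
      \<comment> \<open>The angle from \<open>f p\<close> to \<open>f x\<close>, as a fraction of a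
        full turn.\<close>
      define t where "t = Arg2pi (f x / f p) / (2 * pi)"
      have "f x / f p = cis (Arg2pi (f x / f p))"
        using Arg2pi_eq[of "f x / f p"] fx fp by (simp add: norm_divide cis_conv_exp)
      moreover have "f p \<noteq> 0" using fp by auto
      ultimately have "z t = f x"
        by (simp add: z_def t_def field_simps)
      moreover have "t \<in> {0..1}"
        using Arg2pi_ge_0[of "f x / f p"] Arg2pi_lt_2pi[of "f x / f p"] by (simp add: t_def)
      ultimately show "x \<in> (\<lambda>t. g (z t)) ` {0..1}"
        using gf[OF x] by (metis image_eqI)
    qed
  qed
qed

text \<open>Otherwise the circle would lie inside one open edge, and one coordinate of its
  parametrization would be an injective real loop.\<close>

lemma circle_meets_lattice_points:
  assumes "K homeomorphic sphere (0::complex) 1" "K \<subseteq> cubic_lattice"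
  shows "K \<inter> lattice_points \<noteq> {}"
proof
  assume empty: "K \<inter> lattice_points = {}"
  have "K \<noteq> {}"
  proof
    assume "K = {}"
    then have "sphere (0::complex) 1 = {}"
      using assms(1) by (auto simp: homeomorphic_def homeomorphism_def)
    then show False by simp
  qed
  then obtain x0 where "x0 \<in> K" by blast
  obtain \<gamma> where \<gamma>: "continuous_on {0..1} \<gamma>" "\<gamma> 0 = x0" "\<gamma> 1 = x0" "inj_on \<gamma> {0..<1::real}" "\<gamma> ` {0..1} = K"
    by (rule circle_parametrization[OF assms(1) \<open>x0 \<in> K\<close>])
  have "connected K"
    using connected_continuous_image[OF \<gamma>(1)] \<gamma>(5) by simp
  then obtain j where j: "\<And>x i. x \<in> K \<Longrightarrow> i \<noteq> j \<Longrightarrow> x $ i = x0 $ i"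
    using connected_off_lattice_points[OF _ \<open>x0 \<in> K\<close> assms(2) empty] by metis
  have "inj_on (\<lambda>t. \<gamma> t $ j) {0..<1}"
  proof (rule inj_onI)
    fix s t :: real assume st: "s \<in> {0..<1}" "t \<in> {0..<1}" "\<gamma> s $ j = \<gamma> t $ j"
    have "\<gamma> s \<in> K" "\<gamma> t \<in> K"
      using st \<gamma>(5) by auto
    then have "\<gamma> s $ i = \<gamma> t $ i" for i
      using st j[of "\<gamma> s" i] j[of "\<gamma> t" i] by (cases "i = j") auto
    then have "\<gamma> s = \<gamma> t" by (simp add: vec_eq_iff)
    then show "s = t" using \<gamma>(4) st by (auto dest: inj_onD)
  qed
  moreover have "continuous_on {0..1} (\<lambda>t. \<gamma> t $ j)"
    using \<gamma>(1) by (intro continuous_intros)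
  ultimately show False
    using no_injective_real_loop[of 0 1 "\<lambda>t. \<gamma> t $ j"] \<gamma> by auto
qed

section \<open>Counting lattice points along a path\<close>

lemma dist_lattice_points:
  assumes "x \<in> lattice_points" "y \<in> lattice_points" "x \<noteq> (y :: real^'n)"
  shows "1 \<le> dist x y"
proof -
  obtain i where "x $ i \<noteq> y $ i"
    using assms(3) by (auto simp: vec_eq_iff)
  moreover have "x $ i - y $ i \<in> \<int>"
    using assms by (auto simp: lattice_points_def)
  ultimately have "1 \<le> \<bar>x $ i - y $ i\<bar>"
    by (intro Ints_nonzero_abs_ge1) auto
  also have "\<dots> \<le> dist x y"
    using component_le_norm_cart[of "x - y" i] by (simp add: dist_norm)
  finally show ?thesis .
qed

lemma finite_lattice_points_Int_bounded:
  assumes "bounded (K :: (real^'n) set)"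
  shows "finite (K \<inter> lattice_points)"
proof -
  have "uniform_discrete (K \<inter> lattice_points)"
    unfolding uniform_discrete_def using dist_lattice_points
    by (intro exI[of _ 1]) force
  moreover have "bounded (K \<inter> lattice_points)"
    using assms by (simp add: bounded_Int)
  ultimately show ?thesis
    using uniform_discrete_finite_iff by blast
qed

text \<open>The order in which the path visits the points is irrelevant, as any two of them are at distance at least one.\<close>

lemma path_length_ge_card:
  assumes "finite P" "P \<subseteq> g ` {0..1}" "P \<subseteq> lattice_points"
  shows "ereal (real (card P) - 1) \<le> path_length (g :: real \<Rightarrow> real^'n)"
proof -
  \<comment> \<open>One parameter is chosen for each point of \<open>P\<close>. Sorted, these give
    an inscribed polygon with sides of length at least 1.\<close>
  obtain Q where Q: "Q \<subseteq> {0..1}" "inj_on g Q" "g ` Q = P"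
    using assms(2) by (auto simp: subset_image_inj)
  have "finite Q" using Q assms(1) finite_image_iff by blast
  define ts where "ts = sorted_list_of_set Q"
  have ts: "sorted ts" "set ts = Q" "distinct ts" "length ts = card P"
    using \<open>finite Q\<close> Q card_image[OF Q(2)] by (auto simp: ts_def)
  have "1 \<le> dist (g (ts ! i)) (g (ts ! Suc i))" if "i < length ts - 1" for i
  proof (rule dist_lattice_points)
    have i: "ts ! i \<in> Q" "ts ! Suc i \<in> Q" "ts ! i \<noteq> ts ! Suc i"
      using that ts by (auto simp: nth_eq_iff_index_eq simp flip: ts(2))
    then show "g (ts ! i) \<in> lattice_points" "g (ts ! Suc i) \<in> lattice_points" "g (ts ! i) \<noteq> g (ts ! Suc i)"
      using Q assms(3) by (auto dest: inj_onD)
  qed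
  then have "(\<Sum>i<length ts - 1. 1) \<le> (\<Sum>i<length ts - 1. dist (g (ts ! i)) (g (ts ! Suc i)))"
    by (intro sum_mono) auto
  then have "real (card P) - 1 \<le> (\<Sum>i<length ts - 1. dist (g (ts ! i)) (g (ts ! Suc i)))"
    using ts(4) by simp
  also have "ereal \<dots> \<le> path_length g"
    unfolding path_length_def using ts Q by (intro SUP_upper) auto
  finally show ?thesis by simp
qed

text \<open>The parameters \<open>p\<close> and \<open>q\<close> cut the loop into two closed arcs
  that meet only at the cut points. As \<open>S\<close> avoids these points and is connected, it
  cannot meet both arcs.\<close>

lemma connected_subset_of_loop:
  fixes \<gamma> :: "real \<Rightarrow> 'a::metric_space"
  assumes cont: "continuous_on {0..1} \<gamma>" and loop: "\<gamma> 0 = \<gamma> 1" and inj: "inj_on \<gamma> {0..<1}"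
    and "connected S" "S \<subseteq> \<gamma> ` {0..1}" and pq: "0 \<le> p" "p < q" "q \<le> 1" and off: "\<gamma> p \<notin> S" "\<gamma> q \<notin> S"
    and s: "p < s" "s < q" "\<gamma> s \<in> S" and t: "0 \<le> t" "t \<le> 1" "t < p \<or> q < t" "\<gamma> t \<in> S"
  shows False
proof -
  have eq: "x = y \<or> (x = 0 \<and> y = 1) \<or> (x = 1 \<and> y = 0)"
    if "x \<in> {0..1}" "y \<in> {0..1}" "\<gamma> x = \<gamma> y" for x y
  proof -
    have zero: "z = 0" if "z \<in> {0..<1}" "\<gamma> z = \<gamma> 1" for z
      using inj_onD[OF inj, of z 0] that loop by simp
    show ?thesis
    proof (cases "x = 1 \<or> y = 1")
      case True
      then show ?thesis
        using that zero[of x] zero[of y] by force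
    next
      case False
      then show ?thesis
        using that inj_onD[OF inj, of x y] by simp
    qed
  qed
  define C D where "C = \<gamma> ` {p..q}" and "D = \<gamma> ` ({0..p} \<union> {q..1})"
  have "closed C" "closed D"
    unfolding C_def D_def using pq
    by (auto intro!: compact_imp_closed compact_continuous_image continuous_on_subset[OF cont])
  moreover have "S \<subseteq> C \<union> D"
  proof -
    have "\<gamma> ` {0..1} \<subseteq> \<gamma> ` ({p..q} \<union> ({0..p} \<union> {q..1}))"
      by (rule image_mono) auto
    also have "\<dots> = C \<union> D"
      unfolding C_def D_def by (rule image_Un)
    finally show ?thesis using assms(5) by simp
  qed
  moreover have "C \<inter> D \<inter> S = {}"
  proof (rule ccontr)
    assume "C \<inter> D \<inter> S \<noteq> {}"
    then obtain x y where xy: "x \<in> {p..q}" "y \<in> {0..p} \<union> {q..1}" "\<gamma> x = \<gamma> y" "\<gamma> x \<in> S"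
      unfolding C_def D_def by blast
    then have "x = p \<or> x = q"
      using eq[of x y] pq by auto
    then show False using xy off by auto
  qed
  moreover have "\<gamma> s \<in> C" "\<gamma> t \<in> D"
    using s t pq unfolding C_def D_def by (auto intro!: imageI)
  then have "C \<inter> S \<noteq> {}" "D \<inter> S \<noteq> {}"
    using s t by auto
  ultimately show False
    using \<open>connected S\<close> unfolding connected_closed by blast
qed

section \<open>The closed walk of vertices\<close>

definition unit_step :: "real^3 \<Rightarrow> real^3 \<Rightarrow> bool" where
  "unit_step x y \<longleftrightarrow> (\<exists>j \<sigma>. \<bar>\<sigma>\<bar> = 1 \<and> y = x + \<sigma> *\<^sub>R axis j 1)"

text \<open>The walk lists the lattice points in the order of a parametrization. The last
  conclusion, that a connected set through two vertices contains all vertices of one arc between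
  them, controls arbitrary paths in \<open>K\<close>, including those that backtrack.\<close>

lemma lattice_loop_walk:
  assumes circle: "K homeomorphic sphere (0::complex) 1" and lattice: "K \<subseteq> cubic_lattice"
  obtains v :: "nat \<Rightarrow> real^3" and L where
    "L \<ge> 3" "v L = v 0" "inj_on v {..<L}" "\<And>i. i \<le> L \<Longrightarrow> v i \<in> K \<inter> lattice_points"
    "\<And>i. i < L \<Longrightarrow> unit_step (v i) (v (Suc i))"
    "K = (\<Union>i<L. closed_segment (v i) (v (Suc i)))"
    "\<And>S i j. connected S \<Longrightarrow> S \<subseteq> K \<Longrightarrow> i < j \<Longrightarrow> j < L \<Longrightarrow> v i \<in> S \<Longrightarrow> v j \<in> S \<Longrightarrow>
      v ` {i..j} \<subseteq> S \<or> v ` ({..i} \<union> {j..<L}) \<subseteq> S"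
proof -
  obtain p where p: "p \<in> K" "p \<in> lattice_points"
    using circle_meets_lattice_points[OF assms] by blast
  obtain \<gamma> where cont: "continuous_on {0..1} \<gamma>" and ends: "\<gamma> 0 = p" "\<gamma> 1 = p"
    and inj: "inj_on \<gamma> {0..<1::real}" and img: "\<gamma> ` {0..1} = K"
    by (rule circle_parametrization[OF circle p(1)])
  \<comment> \<open>These parameters are finitely many: the compact \<open>K\<close> has finitely
    many lattice points, and \<open>\<gamma>\<close> repeats a value only at the parameter
    1.\<close>
  define T where "T = {t \<in> {0..1}. \<gamma> t \<in> lattice_points}"
  have "compact K"
    using compact_continuous_image[OF cont] img by simp
  then have "finite (K \<inter> lattice_points)"
    by (intro finite_lattice_points_Int_bounded compact_imp_bounded)
  then have "finite (\<gamma> ` (T - {1}))"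
    by (rule finite_subset[rotated]) (use img in \<open>auto simp: T_def\<close>)
  moreover have "inj_on \<gamma> (T - {1})"
    by (rule inj_on_subset[OF inj]) (auto simp: T_def)
  ultimately have "finite T"
    using finite_imageD by force
  have T01: "0 \<in> T" "1 \<in> T" using ends p by (auto simp: T_def)
  define ts where "ts = sorted_list_of_set T"
  have ts: "set ts = T" "sorted_wrt (<) ts" "distinct ts" "sorted ts"
    using \<open>finite T\<close> by (auto simp: ts_def)
  define L where "L = length ts - 1"
  have "card {0, 1::real} \<le> card T"
    using T01 \<open>finite T\<close> by (intro card_mono) auto
  then have len: "length ts = Suc L" "L \<ge> 1"
    by (auto simp: L_def ts_def)
  define \<tau> where "\<tau> i = ts ! i" for i
  have \<tau>_T: "\<tau> i \<in> T" if "i \<le> L" for i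
    using that ts(1) len by (auto simp: \<tau>_def)
  have \<tau>_less: "\<tau> i < \<tau> j" if "i < j" "j \<le> L" for i j
    using that sorted_wrt_nth_less[OF ts(2)] len by (auto simp: \<tau>_def)
  have \<tau>_surj: "\<exists>i\<le>L. t = \<tau> i" if "t \<in> T" for t
    using that ts(1) len unfolding \<tau>_def by (metis in_set_conv_nth less_Suc_eq_le)
  have \<tau>01: "\<tau> i \<in> {0..1}" if "i \<le> L" for i
    using \<tau>_T[OF that] by (simp add: T_def)
  have \<tau>0: "\<tau> 0 = 0"
  proof -
    obtain i where "i \<le> L" "0 = \<tau> i" using \<tau>_surj T01 by blast
    then show ?thesis using \<tau>_less[of 0 i] \<tau>01[of 0] by (cases "i = 0") auto
  qed
  have \<tau>L: "\<tau> L = 1"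
  proof -
    obtain i where "i \<le> L" "1 = \<tau> i" using \<tau>_surj T01 by blast
    then show ?thesis using \<tau>_less[of i L] \<tau>01[of L] by (cases "i = L") auto
  qed
  have gap: "t \<notin> T" if "i < L" "\<tau> i < t" "t < \<tau> (Suc i)" for i t
  proof
    assume "t \<in> T"
    then obtain k where k: "k \<le> L" "t = \<tau> k" using \<tau>_surj by blast
    then show False
      using that \<tau>_less[of k i] \<tau>_less[of "Suc i" k] by (cases "k < i"; cases "k = i"; cases "k = Suc i") auto
  qed
  define v where "v i = \<gamma> (\<tau> i)" for i
  have arc: "\<exists>j \<sigma>. \<bar>\<sigma>\<bar> = 1 \<and> v (Suc i) = v i + \<sigma> *\<^sub>R axis j 1 \<and> \<gamma> ` {\<tau> i..\<tau> (Suc i)} = closed_segment (v i) (v (Suc i))"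
    if "i < L" for i
  proof -
    have t: "0 \<le> \<tau> i" "\<tau> i < \<tau> (Suc i)" "\<tau> (Suc i) \<le> 1"
      using that \<tau>_less \<tau>01[of i] \<tau>01[of "Suc i"] by auto
    obtain j \<sigma> where "\<bar>\<sigma>\<bar> = 1" "\<gamma> (\<tau> (Suc i)) = \<gamma> (\<tau> i) + \<sigma> *\<^sub>R axis j 1"
      "\<gamma> ` {\<tau> i..\<tau> (Suc i)} = closed_segment (\<gamma> (\<tau> i)) (\<gamma> (\<tau> (Suc i)))"
    proof (rule arc_between_lattice_points[of "\<tau> i" "\<tau> (Suc i)" \<gamma>])
      show "continuous_on {\<tau> i..\<tau> (Suc i)} \<gamma>" "inj_on \<gamma> {\<tau> i..<\<tau> (Suc i)}"
        using t by (auto intro: continuous_on_subset[OF cont] inj_on_subset[OF inj])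
      show "\<gamma> ` {\<tau> i..\<tau> (Suc i)} \<subseteq> cubic_lattice"
        using t img lattice by force
      show "\<gamma> (\<tau> i) \<in> lattice_points" "\<gamma> (\<tau> (Suc i)) \<in> lattice_points"
        using \<tau>_T[of i] \<tau>_T[of "Suc i"] \<open>i < L\<close> by (auto simp: T_def)
      show "\<gamma> s \<notin> lattice_points" if "\<tau> i < s" "s < \<tau> (Suc i)" for s
        using gap[OF \<open>i < L\<close> that] that t by (auto simp: T_def)
    qed (use t in auto)
    then show ?thesis unfolding v_def by blast
  qed
  have inj_v: "inj_on v {..<L}"
  proof (rule inj_onI)
    fix i j assume ij: "i \<in> {..<L}" "j \<in> {..<L}" "v i = v j"
    then have "\<tau> i < 1" "\<tau> j < 1"
      using \<tau>_less[of i L] \<tau>_less[of j L] \<tau>L by auto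
    then have "\<tau> i = \<tau> j"
      using ij \<tau>01[of i] \<tau>01[of j] inj_onD[OF inj, of "\<tau> i" "\<tau> j"] by (auto simp: v_def)
    then show "i = j"
      using ij \<tau>_less[of i j] \<tau>_less[of j i] by (cases i j rule: linorder_cases) auto
  qed
  have vL: "v L = v 0"
    using \<tau>0 \<tau>L ends by (simp add: v_def)
  have cover: "{0..\<tau> k} = (\<Union>i<k. {\<tau> i..\<tau> (Suc i)})" if "1 \<le> k" "k \<le> L" for k
    using that
  proof (induction k rule: nat_induct_at_least)
    case base
    then show ?case using \<tau>0 by (simp add: lessThan_Suc)
  next
    case (Suc k)
    have "{0..\<tau> (Suc k)} = {0..\<tau> k} \<union> {\<tau> k..\<tau> (Suc k)}"
      using \<tau>01[of k] \<tau>_less[of k "Suc k"] Suc.prems by auto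
    moreover have "{0..\<tau> k} = (\<Union>i<k. {\<tau> i..\<tau> (Suc i)})"
      using Suc by simp
    ultimately show ?case
      by (simp only: lessThan_Suc UN_insert Un_commute)
  qed
  have segments: "K = (\<Union>i<L. closed_segment (v i) (v (Suc i)))"
  proof -
    have "K = (\<Union>i<L. \<gamma> ` {\<tau> i..\<tau> (Suc i)})"
      using cover[of L] len \<tau>L img by (metis image_UN order_refl)
    also have "\<dots> = (\<Union>i<L. closed_segment (v i) (v (Suc i)))"
      using arc by (intro SUP_cong) auto
    finally show ?thesis .
  qed
  have "L \<noteq> 1"
  proof
    assume "L = 1"
    then obtain j and \<sigma> :: real where "\<bar>\<sigma>\<bar> = 1" "v 0 = v 0 + \<sigma> *\<^sub>R axis j 1"
      using arc[of 0] vL by auto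
    then show False by (auto simp: axis_eq_0_iff)
  qed
  \<comment> \<open>With two steps both arcs would fill the same edge, so the point at the middle
    parameter of the first would be visited again on the second.\<close>
  moreover have "L \<noteq> 2"
  proof
    assume L: "L = 2"
    have t: "0 < \<tau> 1" "\<tau> 1 < 1"
      using \<tau>_less[of 0 1] \<tau>_less[of 1 2] \<tau>0 \<tau>L L by auto
    have "\<gamma> ` {\<tau> 0..\<tau> 1} = \<gamma> ` {\<tau> 1..\<tau> 2}"
    proof -
      have "\<gamma> ` {\<tau> 0..\<tau> 1} = closed_segment (v 0) (v 1)" "\<gamma> ` {\<tau> 1..\<tau> 2} = closed_segment (v 1) (v 2)"
        using arc[of 0] arc[of 1] L by (auto simp: numeral_2_eq_2)
      then show ?thesis
        using vL L by (simp add: closed_segment_commute)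
    qed
    then have "\<gamma> (\<tau> 1 / 2) \<in> \<gamma> ` {\<tau> 1..1}"
      using t \<tau>0 \<tau>L L by auto
    then obtain s where s: "s \<in> {\<tau> 1..1}" "\<gamma> (\<tau> 1 / 2) = \<gamma> s" by blast
    then show False
      using inj_onD[OF inj, of "\<tau> 1 / 2" s] inj_onD[OF inj, of "\<tau> 1 / 2" 0] t ends by (cases "s = 1") auto
  qed
  ultimately have "L \<ge> 3" using len by linarith
  moreover have "v ` {i..j} \<subseteq> S \<or> v ` ({..i} \<union> {j..<L}) \<subseteq> S"
    if S: "connected S" "S \<subseteq> K" and ij: "i < j" "j < L" and vS: "v i \<in> S" "v j \<in> S" for S i j
  proof (rule ccontr)
    assume "\<not> ?thesis"
    \<comment> \<open>Each of the two arcs has a vertex missing from \<open>S\<close>; cutting the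
      loop at these two separates \<open>v i\<close> from \<open>v j\<close>.\<close>
    then obtain a b where ab: "a \<in> {i..j}" "v a \<notin> S" "b \<in> {..i} \<union> {j..<L}" "v b \<notin> S" by blast
    then have "i < a" "a < j" "b < i \<or> j < b" "b < L"
      using vS ij by (auto simp: order_less_le)
    then have \<tau>: "\<tau> i < \<tau> a" "\<tau> a < \<tau> j" "0 \<le> \<tau> i" "\<tau> j \<le> 1" "0 \<le> \<tau> b" "\<tau> b \<le> 1" "b < i \<Longrightarrow> \<tau> b < \<tau> i" "j < b \<Longrightarrow> \<tau> j < \<tau> b"
      using ij \<tau>_less \<tau>01 by auto
    have loop: "\<gamma> 0 = \<gamma> 1" and SK: "S \<subseteq> \<gamma> ` {0..1}" using ends S img by auto
    show False
      using \<open>b < i \<or> j < b\<close>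
    proof
      assume "b < i"
      show False
        by (rule connected_subset_of_loop[OF cont loop inj S(1) SK, of "\<tau> b" "\<tau> a" "\<tau> i" "\<tau> j"])
          (use \<open>b < i\<close> \<tau> ab vS in \<open>auto simp: v_def\<close>)
    next
      assume "j < b"
      show False
        by (rule connected_subset_of_loop[OF cont loop inj S(1) SK, of "\<tau> a" "\<tau> b" "\<tau> j" "\<tau> i"])
          (use \<open>j < b\<close> \<tau> ab vS in \<open>auto simp: v_def\<close>)
    qed
  qed
  moreover have "v i \<in> K \<inter> lattice_points" if "i \<le> L" for i
    using \<tau>_T[OF that] img by (auto simp: v_def T_def)
  moreover have "unit_step (v i) (v (Suc i))" if "i < L" for i
    using arc[OF that] by (auto simp: unit_step_def)
  ultimately show ?thesis
    using that[of L v] vL inj_v segments by blast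
qed

section \<open>Walks with nearly geodesic halves\<close>

text \<open>A step from above 1 to below -1, or back, would exceed 2, so without a small value the
  sign could never change.\<close>

lemma discrete_antipodal_small:
  fixes f :: "nat \<Rightarrow> real"
  assumes "f n = - f 0" "0 < n" "\<And>t. t < n \<Longrightarrow> \<bar>f (Suc t) - f t\<bar> \<le> 2"
  shows "\<exists>t<n. \<bar>f t\<bar> \<le> 1"
proof (rule ccontr)
  assume "\<not> ?thesis"
  then have big: "\<bar>f t\<bar> > 1" if "t \<le> n" for t
    using that assms(1,2) by (cases "t = n") (auto simp: not_le)
  have "f t * f 0 > 0" if "t \<le> n" for t
    using that
  proof (induction t)
    case 0
    then show ?case using big[of 0] by (auto simp: zero_less_mult_iff)
  next
    case (Suc t)
    then show ?case using big[of t] big[of "Suc t"] assms(3)[of t]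
      by (auto simp: zero_less_mult_iff abs_if split: if_splits)
  qed
  from this[of n] show False using assms(1) by (auto simp: zero_less_mult_iff)
qed

lemma unit_step_component:
  assumes "unit_step x y"
  shows "y $ j - x $ j \<in> {-1, 0, 1}" "(\<Sum>j\<in>UNIV. \<bar>y $ j - x $ j\<bar>) = 1"
    "\<bar>(\<Sum>j\<in>UNIV. y $ j) - (\<Sum>j\<in>UNIV. x $ j)\<bar> = 1"
proof -
  obtain k \<sigma> where \<sigma>: "\<bar>\<sigma>\<bar> = 1" "y = x + \<sigma> *\<^sub>R axis k 1"
    using assms by (auto simp: unit_step_def)
  then have diff: "y $ j - x $ j = (if j = k then \<sigma> else 0)" for j
    by (simp add: axis_def)
  then have "\<bar>y $ j - x $ j\<bar> = (if j = k then 1 else 0)" for j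
    using \<sigma>(1) by simp
  with diff \<sigma>(1) show "y $ j - x $ j \<in> {-1, 0, 1}" "(\<Sum>j\<in>UNIV. \<bar>y $ j - x $ j\<bar>) = 1"
      "\<bar>(\<Sum>j\<in>UNIV. y $ j) - (\<Sum>j\<in>UNIV. x $ j)\<bar> = 1"
    by (auto simp: abs_if simp flip: sum_subtractf split: if_splits)
qed

text \<open>Here \<open>g j\<close> is half the number of all steps along axis \<open>j\<close>.
  Every window of \<open>n\<close> steps uses the axes equally often, and this rigidity identifies
  the walk later.\<close>

lemma near_geodesic_walk:
  fixes v :: "nat \<Rightarrow> real^3"
  assumes closed: "v (2 * n) = v 0" and "0 < n"
    and step: "\<And>i. i < 2 * n \<Longrightarrow> unit_step (v i) (v (Suc i))"
    and geo: "\<And>t. t < n \<Longrightarrow> 11 * real n < 12 * dist1 (v t) (v (t + n))"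
  obtains g :: "3 \<Rightarrow> real" where "n < 4" "(\<Sum>j\<in>UNIV. g j) = real n" "\<And>j. g j = 0 \<or> g j = 1"
    "\<And>t j. t \<le> n \<Longrightarrow> (\<Sum>i=t..<t + n. \<bar>v (Suc i) $ j - v i $ j\<bar>) = g j"
proof -
  define D where "D i j = \<bar>v (Suc i) $ j - v i $ j\<bar>" for i j
  define c where "c j = (\<Sum>i<2 * n. D i j)" for j
  define s where "s t j = (\<Sum>i=t..<t + n. D i j)" for t j
  define f where "f t j = v (t + n) $ j - v t $ j" for t j
  have sum_c: "(\<Sum>j\<in>UNIV. c j) = 2 * n"
  proof -
    have "(\<Sum>j\<in>UNIV. c j) = (\<Sum>i<2 * n. \<Sum>j\<in>UNIV. D i j)"
      unfolding c_def by (rule sum.swap)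
    also have "\<dots> = (\<Sum>i<2 * n. 1)"
      using step unit_step_component(2) by (intro sum.cong) (auto simp: D_def)
    finally show ?thesis by simp
  qed
  have telescope: "\<bar>v b $ j - v a $ j\<bar> \<le> (\<Sum>i=a..<b. D i j)" if "a \<le> b" for a b j
    unfolding D_def sum_Suc_diff'[OF that, of "\<lambda>i. v i $ j", symmetric] by (rule sum_abs)
  have f_le_s: "\<bar>f t j\<bar> \<le> s t j" for t j
    using telescope[of t "t + n" j] by (simp add: f_def s_def)
  have split: "c j = (\<Sum>i=0..<t. D i j) + s t j + (\<Sum>i=t + n..<2 * n. D i j)" if "t \<le> n" for t j
    using that by (simp add: c_def s_def lessThan_atLeast0 sum.atLeastLessThan_concat)
  \<comment> \<open>The rest of the closed walk joins the same two vertices, so its steps bound the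
    difference too.\<close>
  have f_le_cs: "\<bar>f t j\<bar> \<le> c j - s t j" if "t \<le> n" for t j
    using telescope[of 0 t j] telescope[of "t + n" "2 * n" j] split[OF that, of j] closed that
    by (simp add: f_def)
  have f_le: "\<bar>f t j\<bar> \<le> c j / 2" if "t \<le> n" for t j
    using f_le_s[of t j] f_le_cs[OF that, of j] by simp
  have dist1: "dist1 (v t) (v (t + n)) = (\<Sum>j\<in>UNIV. \<bar>f t j\<bar>)" for t
    by (simp add: dist1_def f_def abs_minus_commute)
  have w: "v (Suc i) $ j - v i $ j \<in> {-1, 0, 1}" if "i < 2 * n" for i j
    using unit_step_component(1)[OF step[OF that]] .
  \<comment> \<open>At a window where \<open>f t j\<close> is at most 1 in size, the distance
    hypothesis gives \<open>11 n < 12 (1 + n - c j / 2)\<close>, which rearranges to this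
    bound.\<close>
  have c_bound: "6 * c j < 12 + real n" for j
  proof -
    have "f n j = - f 0 j"
      using closed by (simp add: f_def mult_2)
    moreover have "\<bar>f (Suc t) j - f t j\<bar> \<le> 2" if "t < n" for t
      using w[of t j] w[of "t + n" j] that by (auto simp: f_def)
    ultimately obtain t where t: "t < n" "\<bar>f t j\<bar> \<le> 1"
      using discrete_antipodal_small[of "\<lambda>t. f t j" n] \<open>0 < n\<close> by blast
    have "(\<Sum>i\<in>UNIV. \<bar>f t i\<bar>) = \<bar>f t j\<bar> + (\<Sum>i\<in>UNIV - {j}. \<bar>f t i\<bar>)"
      by (rule sum.remove) auto
    also have "\<dots> \<le> 1 + (\<Sum>i\<in>UNIV - {j}. c i / 2)"
      using t f_le by (intro add_mono sum_mono) auto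
    also have "(\<Sum>i\<in>UNIV - {j}. c i / 2) = (\<Sum>i\<in>UNIV. c i / 2) - c j / 2"
      by (subst sum.remove[of UNIV j "\<lambda>i. c i / 2"]) auto
    also have "(\<Sum>i\<in>UNIV. c i / 2) = real n"
      using sum_c by (simp flip: sum_divide_distrib)
    finally show ?thesis
      using geo[OF t(1)] dist1[of t] by simp
  qed
  \<comment> \<open>Adding the three bounds gives \<open>12 n < 36 + 3 n\<close>.\<close>
  have n4: "n < 4"
    using c_bound[of 1] c_bound[of 2] c_bound[of 3] sum_c by (simp add: sum_3)
  have w_Ints: "v (Suc i) $ j - v i $ j \<in> \<int>" if "i < 2 * n" for i j
    using w[OF that, of j] by auto
  have f_Ints: "f t j \<in> \<int>" if "t \<le> n" for t j
  proof -
    have "f t j = (\<Sum>i=t..<t + n. v (Suc i) $ j - v i $ j)"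
      unfolding f_def by (rule sum_Suc_diff'[symmetric]) simp
    also have "\<dots> \<in> \<int>"
      using that by (intro Ints_sum w_Ints) auto
    finally show ?thesis .
  qed
  have f_eq: "\<bar>f t j\<bar> = c j / 2" if "t < n" for t j
  proof -
    have "dist1 (v t) (v (t + n)) \<in> \<int>"
      unfolding dist1 using that by (intro Ints_sum Ints_abs f_Ints) auto
    then obtain d where d: "dist1 (v t) (v (t + n)) = of_int d"
      by (elim Ints_cases)
    \<comment> \<open>An integer above \<open>11 n / 12\<close> is at least \<open>n\<close>, since
      \<open>n < 12\<close>. Hence the bounds \<open>c j / 2\<close>, which add up to
      \<open>n\<close>, are all attained.\<close>
    have "12 * d > 11 * int n"
      using geo[OF that] unfolding d by linarith
    then have "d \<ge> int n" using n4 by linarith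
    then have "(\<Sum>j\<in>UNIV. c j / 2) \<le> (\<Sum>j\<in>UNIV. \<bar>f t j\<bar>)"
      using d dist1[of t] sum_c by (simp flip: sum_divide_distrib)
    moreover have "(\<Sum>i\<in>UNIV. \<bar>f t i\<bar>) < (\<Sum>i\<in>UNIV. c i / 2)" if "\<bar>f t j\<bar> \<noteq> c j / 2"
      using f_le[of t] \<open>t < n\<close> that by (intro sum_strict_mono_ex1) (auto simp: order_less_le)
    ultimately show ?thesis by linarith
  qed
  show ?thesis
  proof
    show "n < 4" by fact
    show "(\<Sum>j\<in>UNIV. c j / 2) = real n"
      using sum_c by (simp flip: sum_divide_distrib)
    show "c j / 2 = 0 \<or> c j / 2 = 1" for j
    proof -
      have "c j / 2 \<in> \<int>"
        using f_Ints[of 0 j] f_eq[of 0 j] \<open>0 < n\<close> by (metis Ints_abs less_imp_le)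
      then obtain k where k: "c j / 2 = of_int k"
        by (elim Ints_cases)
      have "0 \<le> c j" unfolding c_def D_def by (intro sum_nonneg) auto
      \<comment> \<open>From \<open>6 c j < 12 + n < 16\<close> the integer \<open>c j / 2\<close>
        is below 2.\<close>
      then have "0 \<le> k" "k < 2"
        using k c_bound[of j] n4 by linarith+
      then have "k = 0 \<or> k = 1" by linarith
      then show ?thesis using k by auto
    qed
    \<comment> \<open>Both \<open>s t j\<close> and \<open>c j - s t j\<close> are at least
      \<open>c j / 2\<close>, hence equal to it. The window starting at \<open>n\<close> is handled
      below as the complement of the one starting at 0.\<close>
    have s_eq: "s t j = c j / 2" if "t < n" for t j
      using f_le_s[of t j] f_le_cs[of t j] f_eq[OF that, of j] that by simp
    show "(\<Sum>i=t..<t + n. \<bar>v (Suc i) $ j - v i $ j\<bar>) = c j / 2" if "t \<le> n" for t j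
    proof (cases "t = n")
      case True
      then have "s t j = c j - s 0 j"
        using split[of 0 j] by (simp add: s_def mult_2)
      then show ?thesis
        using s_eq[of 0 j] \<open>0 < n\<close> by (simp add: s_def D_def)
    next
      case False
      then show ?thesis using s_eq[of t j] that by (simp add: s_def D_def)
    qed
  qed
qed

text \<open>Every step changes the coordinate sum by 1 or -1, so the parity of the sum alternates
  along the walk.\<close>

lemma closed_walk_even:
  assumes "v L = v 0" and step: "\<And>i. i < L \<Longrightarrow> unit_step (v i) (v (Suc i))"
  shows "even L"
proof -
  define h where "h i = (\<Sum>j\<in>UNIV. v i $ j)" for i
  have "\<exists>k::int. h i - h 0 = of_int k \<and> even (k + int i)" if "i \<le> L" for i
    using that
  proof (induction i)
    case (Suc i)
    then obtain k :: int where k: "h i - h 0 = of_int k" "even (k + int i)" by auto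
    have "\<bar>h (Suc i) - h i\<bar> = 1"
      using unit_step_component(3)[OF step, of i] Suc.prems by (simp add: h_def)
    then have "h (Suc i) - h 0 = of_int (k + 1) \<or> h (Suc i) - h 0 = of_int (k - 1)"
      using k(1) by auto
    moreover have "even (k + 1 + int (Suc i))" "even (k - 1 + int (Suc i))"
      using k(2) by simp_all
    ultimately show ?case by blast
  qed auto
  from this[of L] show ?thesis using assms(1) by (auto simp: h_def)
qed

text \<open>The sets \<open>A\<close> and \<open>B\<close> stand for the vertices of the two arcs
  between \<open>x\<close> and \<open>y\<close>. A path joining \<open>x\<close> to \<open>y\<close>
  contains one of them, hence \<open>n + 1\<close> lattice points, and so has length at least
  \<open>n\<close>.\<close>

lemma knot_dist_ge:
  assumes sep: "\<And>S. connected S \<Longrightarrow> S \<subseteq> K \<Longrightarrow> x \<in> S \<Longrightarrow> y \<in> S \<Longrightarrow> A \<subseteq> S \<or> B \<subseteq> S"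
    and "finite A" "A \<subseteq> lattice_points" "card A = Suc n" "finite B" "B \<subseteq> lattice_points" "card B = Suc n"
  shows "ereal (real n) \<le> knot_dist K x y"
  unfolding knot_dist_def
proof (rule INF_greatest)
  fix g assume g: "g \<in> {g. path g \<and> path_image g \<subseteq> K \<and> pathstart g = x \<and> pathfinish g = y}"
  then have "x \<in> path_image g" "y \<in> path_image g"
    by auto
  then have "A \<subseteq> path_image g \<or> B \<subseteq> path_image g"
    using g by (intro sep connected_path_image) auto
  then show "ereal (real n) \<le> path_length g"
    using path_length_ge_card[of A g] path_length_ge_card[of B g] assms by (auto simp: path_image_def)
qed

lemma dist1_pos:
  assumes "x \<noteq> y"
  shows "dist1 x y > 0"
proof -
  obtain i where "x $ i \<noteq> y $ i"
    using assms by (auto simp: vec_eq_iff)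
  then show ?thesis
    unfolding dist1_def by (intro sum_pos2[of _ i]) auto
qed

lemma knot_dist_le_vertex_distortion:
  assumes "finite (vertices K)" "x \<in> vertices K" "y \<in> vertices K" "x \<noteq> y"
  shows "knot_dist K x y / ereal (dist1 x y) \<le> vertex_distortion K"
proof -
  have "distortion_ratio K x y \<le> vertex_distortion K"
    unfolding vertex_distortion_def using assms by (intro Max_ge) auto
  then show ?thesis using assms(4) by (simp add: distortion_ratio_def)
qed

section \<open>Walks of length four and six\<close>

lemma four_walk_square:
  fixes v :: "nat \<Rightarrow> real^3"
  assumes closed: "v 4 = v 0" and step: "\<And>i. i < 4 \<Longrightarrow> unit_step (v i) (v (Suc i))"
    and g: "(\<Sum>j\<in>UNIV. g j) = 2" "\<And>j. g j = 0 \<or> g j = 1"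
    and window: "\<And>t j. t \<le> 2 \<Longrightarrow> (\<Sum>i=t..<t + 2. \<bar>v (Suc i) $ j - v i $ j\<bar>) = g j"
  shows "ambient_isotopic (\<Union>i<4. closed_segment (v i) (v (Suc i))) unknot"
proof -
  define w where "w i = v (Suc i) - v i" for i
  have w: "w i $ j \<in> {-1, 0, 1}" if "i < 4" for i j
    using unit_step_component(1)[OF step[OF that]] by (simp add: w_def)
  have win: "\<bar>w 0 $ j\<bar> + \<bar>w 1 $ j\<bar> = g j" "\<bar>w 1 $ j\<bar> + \<bar>w 2 $ j\<bar> = g j" "\<bar>w 2 $ j\<bar> + \<bar>w 3 $ j\<bar> = g j" for j
    using window[of 0 j] window[of 1 j] window[of 2 j] by (simp_all add: w_def numeral_eq_Suc)
  have "w 0 + w 1 + w 2 + w 3 = 0"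
    using closed by (simp add: w_def numeral_eq_Suc)
  then have zero: "w 0 $ j + w 1 $ j + w 2 $ j + w 3 $ j = 0" for j
    by (metis vector_add_component zero_index)
  \<comment> \<open>Overlapping windows make opposite steps use the same axis, and closedness makes
    their signs opposite. Since \<open>g j\<close> is at most 1, adjacent steps use different
    axes.\<close>
  have "w 2 $ j = - w 0 $ j \<and> w 3 $ j = - w 1 $ j \<and> w 0 $ j * w 1 $ j = 0" for j
  proof -
    have abs: "\<bar>w 2 $ j\<bar> = \<bar>w 0 $ j\<bar>" "\<bar>w 3 $ j\<bar> = \<bar>w 1 $ j\<bar>"
      using win[of j] by linarith+
    have "w 0 $ j = 0 \<or> w 1 $ j = 0"
      using win(1)[of j] g(2)[of j] w[of 0 j] w[of 1 j] by auto
    then show ?thesis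
    proof
      assume "w 0 $ j = 0"
      with abs zero[of j] show ?thesis by simp
    next
      assume "w 1 $ j = 0"
      with abs zero[of j] show ?thesis by simp
    qed
  qed
  then have w23: "w 2 = - w 0" "w 3 = - w 1" and w01: "\<And>j. w 0 $ j * w 1 $ j = 0"
    by (auto simp: vec_eq_iff)
  have norm1: "(\<Sum>j\<in>UNIV. \<bar>w i $ j\<bar>) = 1" if "i < 4" for i
    using unit_step_component(2)[OF step[OF that]] by (simp add: w_def)
  \<comment> \<open>For entries -1, 0 and 1 squares are absolute values, so the unit length in the
    l1 norm is also the Euclidean one.\<close>
  have sq: "w i $ j * w i $ j = \<bar>w i $ j\<bar>" if "i < 4" for i j
    using w[OF that, of j] by auto
  \<comment> \<open>The axis along which no step runs serves as the normal of the square.\<close>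
  obtain k where k: "g k = 0"
    using g(1) g(2)[of 1] g(2)[of 2] g(2)[of 3] by (auto simp: sum_3)
  then have "w 0 $ k = 0" "w 1 $ k = 0"
    using win(1)[of k] by auto
  moreover have "w 0 \<bullet> w 0 = 1" "w 1 \<bullet> w 1 = 1" "w 0 \<bullet> w 1 = 0"
    using norm1[of 0] norm1[of 1] by (simp_all only: inner_vec_def inner_real_def sq w01 sum.neutral_const)
  ultimately have "orthonormal3 (w 0) (w 1) (axis k 1)"
    by (simp add: orthonormal3_def inner_axis)
  from unit_square_unknot[OF this, of "v 0"]
  have "ambient_isotopic (closed_segment (v 0) (v 0 + w 0) \<union> closed_segment (v 0 + w 0) (v 0 + w 0 + w 1) \<union>
    closed_segment (v 0 + w 0 + w 1) (v 0 + w 1) \<union> closed_segment (v 0 + w 1) (v 0)) unknot" .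
  moreover have "v 1 = v 0 + w 0" "v 2 = v 0 + w 0 + w 1"
    by (simp_all add: w_def numeral_eq_Suc)
  moreover have "v 3 = v 0 + w 1"
  proof -
    have "v 3 = v 2 + w 2"
      by (simp add: w_def numeral_eq_Suc)
    then show ?thesis
      using w23 \<open>v 2 = _\<close> by simp
  qed
  ultimately show ?thesis
    using closed by (simp add: numeral_eq_Suc lessThan_Suc Un_ac)
qed

lemma six_walk_hexagon:
  fixes v :: "nat \<Rightarrow> real^3"
  assumes closed: "v 6 = v 0" and step: "\<And>i. i < 6 \<Longrightarrow> unit_step (v i) (v (Suc i))"
    and window: "\<And>t j. t \<le> 3 \<Longrightarrow> (\<Sum>i=t..<t + 3. \<bar>v (Suc i) $ j - v i $ j\<bar>) = 1"
  shows "ambient_isotopic (\<Union>i<6. closed_segment (v i) (v (Suc i))) unknot"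
proof -
  define w where "w i = v (Suc i) - v i" for i
  have w: "w i $ j \<in> {-1, 0, 1}" if "i < 6" for i j
    using unit_step_component(1)[OF step[OF that]] by (simp add: w_def)
  have win: "\<bar>w 0 $ j\<bar> + \<bar>w 1 $ j\<bar> + \<bar>w 2 $ j\<bar> = 1" "\<bar>w 1 $ j\<bar> + \<bar>w 2 $ j\<bar> + \<bar>w 3 $ j\<bar> = 1"
    "\<bar>w 2 $ j\<bar> + \<bar>w 3 $ j\<bar> + \<bar>w 4 $ j\<bar> = 1" "\<bar>w 3 $ j\<bar> + \<bar>w 4 $ j\<bar> + \<bar>w 5 $ j\<bar> = 1" for j
    using window[of 0 j] window[of 1 j] window[of 2 j] window[of 3 j] by (simp_all add: w_def numeral_eq_Suc)
  have "w 0 + w 1 + w 2 + w 3 + w 4 + w 5 = 0"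
    using closed by (simp add: w_def numeral_eq_Suc)
  then have zero: "w 0 $ j + w 1 $ j + w 2 $ j + w 3 $ j + w 4 $ j + w 5 $ j = 0" for j
    by (metis vector_add_component zero_index)
  \<comment> \<open>As for the square, opposite steps cancel. Three consecutive steps now use all
    three axes, so the first three form an orthonormal basis.\<close>
  have "w 3 $ j = - w 0 $ j \<and> w 4 $ j = - w 1 $ j \<and> w 5 $ j = - w 2 $ j \<and>
    w 0 $ j * w 1 $ j = 0 \<and> w 0 $ j * w 2 $ j = 0 \<and> w 1 $ j * w 2 $ j = 0" for j
  proof -
    have abs: "\<bar>w 3 $ j\<bar> = \<bar>w 0 $ j\<bar>" "\<bar>w 4 $ j\<bar> = \<bar>w 1 $ j\<bar>" "\<bar>w 5 $ j\<bar> = \<bar>w 2 $ j\<bar>"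
      using win[of j] by linarith+
    consider "w 0 $ j = 0" "w 1 $ j = 0" | "w 0 $ j = 0" "w 2 $ j = 0" | "w 1 $ j = 0" "w 2 $ j = 0"
      using w[of 0 j] w[of 1 j] w[of 2 j] win(1)[of j] by force
    then show ?thesis
      by cases (use abs zero[of j] in simp_all)
  qed
  then have w345: "w 3 = - w 0" "w 4 = - w 1" "w 5 = - w 2"
    and orth: "\<And>j. w 0 $ j * w 1 $ j = 0" "\<And>j. w 0 $ j * w 2 $ j = 0" "\<And>j. w 1 $ j * w 2 $ j = 0"
    by (auto simp: vec_eq_iff)
  have norm1: "(\<Sum>j\<in>UNIV. \<bar>w i $ j\<bar>) = 1" if "i < 6" for i
    using unit_step_component(2)[OF step[OF that]] by (simp add: w_def)
  have sq: "w i $ j * w i $ j = \<bar>w i $ j\<bar>" if "i < 6" for i j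
    using w[OF that, of j] by auto
  have "orthonormal3 (w 0) (w 1) (w 2)"
    using norm1[of 0] norm1[of 1] norm1[of 2]
    by (simp only: orthonormal3_def inner_vec_def inner_real_def sq orth sum.neutral_const)
  from cube_hexagon_unknot[OF this, of "v 0"]
  have "ambient_isotopic (closed_segment (v 0) (v 0 + w 0) \<union> closed_segment (v 0 + w 0) (v 0 + w 0 + w 1) \<union>
    closed_segment (v 0 + w 0 + w 1) (v 0 + w 0 + w 1 + w 2) \<union>
    closed_segment (v 0 + w 0 + w 1 + w 2) (v 0 + w 1 + w 2) \<union>
    closed_segment (v 0 + w 1 + w 2) (v 0 + w 2) \<union> closed_segment (v 0 + w 2) (v 0)) unknot" .
  moreover have v: "v 1 = v 0 + w 0" "v 2 = v 0 + w 0 + w 1" "v 3 = v 0 + w 0 + w 1 + w 2"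
    by (simp_all add: w_def numeral_eq_Suc)
  moreover have v4: "v 4 = v 0 + w 1 + w 2"
  proof -
    have "v 4 = v 3 + w 3"
      by (simp add: w_def numeral_eq_Suc)
    then show ?thesis
      using w345(1) v(3) by simp
  qed
  moreover have "v 5 = v 0 + w 2"
  proof -
    have "v 5 = v 4 + w 4"
      by (simp add: w_def numeral_eq_Suc)
    then show ?thesis
      using w345(2) v4 by simp
  qed
  ultimately show ?thesis
    using closed by (simp add: numeral_eq_Suc lessThan_Suc Un_ac)
qed

lemma lattice_knot_small_distortion:
  assumes "lattice_knot K" "vertex_distortion K < ereal (12 / 11)"
  shows "ambient_isotopic K unknot"
proof -
  have circle: "K homeomorphic sphere (0::complex) 1" and "K \<subseteq> cubic_lattice"
    using assms(1) by (auto simp: lattice_knot_def polygonal_knot_def knot_def)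
  then obtain v L where L: "L \<ge> 3" and closed: "v L = v 0" and inj: "inj_on v {..<L}"
    and verts: "\<And>i. i \<le> L \<Longrightarrow> v i \<in> K \<inter> lattice_points"
    and step: "\<And>i. i < L \<Longrightarrow> unit_step (v i) (v (Suc i))"
    and K: "K = (\<Union>i<L. closed_segment (v i) (v (Suc i)))"
    and sep: "\<And>S i j. connected S \<Longrightarrow> S \<subseteq> K \<Longrightarrow> i < j \<Longrightarrow> j < L \<Longrightarrow> v i \<in> S \<Longrightarrow> v j \<in> S \<Longrightarrow>
      v ` {i..j} \<subseteq> S \<or> v ` ({..i} \<union> {j..<L}) \<subseteq> S"
    by (rule lattice_loop_walk) blast
  obtain n where n: "L = 2 * n"
    using closed_walk_even[of v L] closed step by (auto elim: evenE)
  have vertices: "vertices K = K \<inter> lattice_points"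
    by (simp add: vertices_def lattice_points_def)
  have "compact K"
    using circle homeomorphic_compactness[of K "sphere (0::complex) 1"] by simp
  then have fin: "finite (vertices K)"
    unfolding vertices by (intro finite_lattice_points_Int_bounded compact_imp_bounded)
  have geo: "11 * real n < 12 * dist1 (v t) (v (t + n))" if "t < n" for t
  proof -
    have tn: "t < t + n" "t + n < L" using that n L by auto
    have neq: "v t \<noteq> v (t + n)"
      using inj_onD[OF inj, of t "t + n"] tn by auto
    then have pos: "dist1 (v t) (v (t + n)) > 0" by (rule dist1_pos)
    \<comment> \<open>Antipodal vertices split the loop into two arcs with \<open>n + 1\<close>
      vertices each; on the second arc the count is \<open>(t + 1) + (n - t)\<close>.\<close>
    have "ereal (real n) \<le> knot_dist K (v t) (v (t + n))"
    proof (rule knot_dist_ge)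
      show "v ` {t..t + n} \<subseteq> S \<or> v ` ({..t} \<union> {t + n..<L}) \<subseteq> S"
        if "connected S" "S \<subseteq> K" "v t \<in> S" "v (t + n) \<in> S" for S
        using sep that tn by blast
      have "card (v ` {t..t + n}) = card {t..t + n}"
        using tn by (intro card_image inj_on_subset[OF inj]) auto
      then show "card (v ` {t..t + n}) = Suc n" by simp
      have "card (v ` ({..t} \<union> {t + n..<L})) = card ({..t} \<union> {t + n..<L})"
        using tn by (intro card_image inj_on_subset[OF inj]) auto
      also have "\<dots> = card {..t} + card {t + n..<L}"
        using tn by (intro card_Un_disjoint) auto
      finally show "card (v ` ({..t} \<union> {t + n..<L})) = Suc n"
        using n tn by simp
    qed (use verts tn in auto)
    then have "ereal (real n) / ereal (dist1 (v t) (v (t + n))) \<le>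
      knot_dist K (v t) (v (t + n)) / ereal (dist1 (v t) (v (t + n)))"
      using pos by (intro ereal_divide_right_mono) auto
    also have "\<dots> \<le> vertex_distortion K"
      using verts tn neq by (intro knot_dist_le_vertex_distortion fin) (auto simp: vertices)
    also have "\<dots> < ereal (12 / 11)" by fact
    finally have "real n / dist1 (v t) (v (t + n)) < 12 / 11"
      using pos by simp
    then show ?thesis using pos by (simp add: field_simps)
  qed
  have "v (2 * n) = v 0" "0 < n" "\<And>i. i < 2 * n \<Longrightarrow> unit_step (v i) (v (Suc i))"
    using closed step n L by auto
  then obtain g where g: "n < 4" "(\<Sum>j\<in>UNIV. g j) = real n" "\<And>j. g j = 0 \<or> g j = 1"
    "\<And>t j. t \<le> n \<Longrightarrow> (\<Sum>i=t..<t + n. \<bar>v (Suc i) $ j - v i $ j\<bar>) = g j"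
    using geo by (rule near_geodesic_walk) (assumption | rule that)+
  \<comment> \<open>An even length of at least 3 is at least 4, so \<open>n\<close> is at least
    2.\<close>
  consider "n = 2" | "n = 3"
    using g(1) n L by linarith
  then show ?thesis
  proof cases
    case 1
    show ?thesis
      unfolding K n 1 using four_walk_square[of v g] closed step g n 1 by simp
  next
    case 2
    \<comment> \<open>Three values in {0, 1} with sum 3 are all 1.\<close>
    have "g j = 1" for j
      using g(2) g(3)[of 1] g(3)[of 2] g(3)[of 3] exhaust_3[of j] 2 by (auto simp: sum_3)
    then show ?thesis
      unfolding K n 2 using six_walk_hexagon[of v] closed step g(4) n 2 by simp
  qed
qed

theorem corollary4p1:
  fixes K :: "(real^3) set"
  assumes "tame_knot K"
    and "class_vertex_distortion (knot_class K) = 1"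
  shows "knot_class K = knot_class unknot"
proof -
  \<comment> \<open>The infimum is not known to be attained, but the gap between 1 and
    \<open>12/11\<close> yields a representative below the threshold of
    \<open>lattice_knot_small_distortion\<close>.\<close>
  have "class_vertex_distortion (knot_class K) < ereal (12 / 11)"
    by (simp add: assms(2) one_ereal_def)
  then obtain K' where K': "K' \<in> knot_class K" "lattice_knot K'" "vertex_distortion K' < ereal (12 / 11)"
    unfolding class_vertex_distortion_def by (auto simp: INF_less_iff)
  then have "ambient_isotopic K unknot"
    using lattice_knot_small_distortion ambient_isotopic_trans unfolding knot_class_def by blast
  then show ?thesis by (rule knot_class_eqI)
qed

end
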